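(* The Jacobian Conjecture for two variables is equivalent to the following statement: Let $f=(f_1,f_2)$ be a pair of polynomials in $\mathbb{C}[x,y]$ with $\mathcal{J}(f)\equiv 1$ such that (RC1) for some positive integer $n$, $f_i=x^n+\text{lower degree terms}$ $(i=1,2)$, i.e. both $f_i$ have total degree $n$ with leading homogeneous part $x^n$; and (RC2) all intersection points of the curves $(f_1)$ and $(f_2)$ in $\mathbb{C}^2$ lie on the line $\{y=0\}$. Let $g=(g_1,g_2)$ be the unique pair of polynomials in $\mathbb{C}[x,y]$ with $\deg g_i\le n-1$ $(i=1,2)$ solving $$y=g_1f_1+g_2f_2 .$$ Then the coefficient of $x^{n-1}$ in $g_2$ equals $1$.
   Context: $\mathcal{J}(f)=\frac{\partial(f_1,f_2)}{\partial(x,y)}=\frac{\partial f_1}{\partial x}\frac{\partial f_2}{\partial y}-\frac{\partial f_1}{\partial y}\frac{\partial f_2}{\partial x}$ denotes the Jacobian determinant, and $(f_i)=\{f_i=0\}\subset\mathbb{C}^2$. $\deg$ denotes total degree in $(x,y)$. The Jacobian Conjecture for two variables is the assertion: for every pair $f=(f_1,f_2)$ of polynomials in $\mathbb{C}[x,y]$ with $\mathcal{J}(f)\equiv 1$, the map $f:\mathbb{C}^2\to\mathbb{C}^2$ is invertible and its inverse is also a polynomial map. (Under (RC1), (RC2) and $\mathcal{J}(f)\equiv1$, a pair $(g_1,g_2)$ with the stated degree bound exists and is unique.) *)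

theory Defs
  imports Complex_Main "HOL-Computational_Algebra.Polynomial"
begin

text \<open>
  \<open>\<complex>[x,y]\<close> is represented as \<open>\<complex>[x][y]\<close>: the outer variable is \<open>y\<close>, the inner one \<open>x\<close>.
\<close>

type_synonym bpoly = "complex poly poly"

definition X :: bpoly where "X = [:[:0, 1:]:]"

definition Y :: bpoly where "Y = [:0, 1:]"

text \<open>\<open>coeff_xy p i j\<close> is the coefficient of \<open>x\<^sup>i y\<^sup>j\<close>.\<close>

definition coeff_xy :: "bpoly \<Rightarrow> nat \<Rightarrow> nat \<Rightarrow> complex" where
  "coeff_xy p i j = coeff (coeff p j) i"

definition eval_xy :: "bpoly \<Rightarrow> complex \<Rightarrow> complex \<Rightarrow> complex" where
  "eval_xy p a b = poly (poly p [:b:]) a"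

text \<open>The zero polynomial gets total degree \<open>0\<close>.\<close>

definition total_degree :: "bpoly \<Rightarrow> nat" where
  "total_degree p = Max (insert 0 {i + j | i j. coeff_xy p i j \<noteq> 0})"

definition partial_x :: "bpoly \<Rightarrow> bpoly" where
  "partial_x p = map_poly pderiv p"

definition partial_y :: "bpoly \<Rightarrow> bpoly" where
  "partial_y p = pderiv p"

definition jacobian :: "bpoly \<times> bpoly \<Rightarrow> bpoly" where
  "jacobian f = partial_x (fst f) * partial_y (snd f) - partial_y (fst f) * partial_x (snd f)"

definition curve :: "bpoly \<Rightarrow> (complex \<times> complex) set" where
  "curve p = {(a, b). eval_xy p a b = 0}"

definition polynomial_map :: "bpoly \<times> bpoly \<Rightarrow> complex \<times> complex \<Rightarrow> complex \<times> complex" where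
  "polynomial_map f = (\<lambda>(a, b). (eval_xy (fst f) a b, eval_xy (snd f) a b))"

definition jacobian_conjecture_2 :: bool where
  "jacobian_conjecture_2 \<longleftrightarrow>
     (\<forall>f. jacobian f = 1 \<longrightarrow>
        bij (polynomial_map f) \<and> (\<exists>h. inv (polynomial_map f) = polynomial_map h))"

text \<open>
  For \<open>n > 0\<close>, the only case used, the convention on the degree of \<open>0\<close> is harmless here:
  the remainder \<open>r\<close> may vanish.
\<close>

definition x_power_plus_lower :: "nat \<Rightarrow> bpoly \<Rightarrow> bool" where
  "x_power_plus_lower n p \<longleftrightarrow> (\<exists>r. p = X ^ n + r \<and> total_degree r < n)"

lemma coeff_xy_X_power [simp]: "coeff_xy (X ^ n) i j = (if i = n \<and> j = 0 then 1 else 0)"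
proof -
  have "X ^ n = [:monom 1 n:]"
    by (simp add: X_def monom_altdef poly_const_pow)
  then show ?thesis
    by (simp add: coeff_xy_def coeff_pCons split: nat.splits)
qed

lemma coeff_xy_partial_x: "coeff_xy (partial_x p) i j = of_nat (Suc i) * coeff_xy p (Suc i) j"
  by (simp add: coeff_xy_def partial_x_def coeff_map_poly coeff_pderiv)

lemma coeff_xy_partial_y: "coeff_xy (partial_y p) i j = of_nat (Suc j) * coeff_xy p i (Suc j)"
  by (simp add: coeff_xy_def partial_y_def coeff_pderiv flip: of_nat_Suc)
     (simp add: of_nat_poly)

lemma eval_xy_X [simp]: "eval_xy X a b = a"
  and eval_xy_Y [simp]: "eval_xy Y a b = b"
  and eval_xy_add [simp]: "eval_xy (p + q) a b = eval_xy p a b + eval_xy q a b"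
  and eval_xy_mult [simp]: "eval_xy (p * q) a b = eval_xy p a b * eval_xy q a b"
  by (simp_all add: eval_xy_def X_def Y_def)

lemma finite_support_degrees: "finite {i + j | i j. coeff_xy p i j \<noteq> 0}"
proof -
  have "{i + j | i j. coeff_xy p i j \<noteq> 0} \<subseteq>
        (\<Union>j\<in>{..degree p}. (\<lambda>i. i + j) ` {..degree (coeff p j)})"
    unfolding coeff_xy_def by (fastforce intro: le_degree)
  then show ?thesis
    by (rule finite_subset) auto
qed

lemma total_degree_le_iff: "total_degree p \<le> d \<longleftrightarrow> (\<forall>i j. coeff_xy p i j \<noteq> 0 \<longrightarrow> i + j \<le> d)"
  unfolding total_degree_def using finite_support_degrees[of p] by (subst Max_le_iff) auto

end

theory Submission
  imports Defs
    "HOL-Computational_Algebra.Polynomial_Factorial"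
    "HOL-Computational_Algebra.Field_as_Ring"
    "Jordan_Normal_Form.Char_Poly"
begin

text \<open>
  If the map \<open>f\<close> is bijective, both \<open>f\<^sub>i(x, 0)\<close> are divisible by \<open>x - a\<close> for the unique zero \<open>(a, 0)\<close>,
  with coprime quotients \<open>a\<^sub>1, a\<^sub>2\<close>. So \<open>g\<^sub>2(x, 0)\<close> is a multiple \<open>c a\<^sub>1\<close>, where \<open>c\<close> is constant for degree
  reasons, and differentiating \<open>y = g\<^sub>1 f\<^sub>1 + g\<^sub>2 f\<^sub>2\<close> with respect to \<open>y\<close> at \<open>(a, 0)\<close> gives \<open>c = 1\<close>.

  Conversely, after a linear change of coordinates in source and target a pair \<open>(F, G)\<close> with
  Jacobian \<open>1\<close> has \<open>F\<close> monic in \<open>y\<close> of degree \<open>d\<close>, \<open>deg\<^sub>y G < d\<close>, and common zeros with distinct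
  \<open>x\<close>-coordinates. Let \<open>R(x)\<close> be the norm of \<open>G\<close> modulo \<open>F\<close>; then \<open>R = U F + V G\<close> with \<open>deg\<^sub>y V < d\<close>, and
  the Jacobian condition forces the coefficient of \<open>y\<^bsup>d-1\<^esup>\<close> in \<open>V\<close> to be \<open>- R'\<close>. The common zeros lie
  on a graph, \<open>y - L\<^sub>0(x) = A F + B G\<close>. For \<open>L = L\<^sub>0 + Q R\<close> of high degree, the substitution \<open>y \<mapsto> y + L\<close>
  moves all zeros to the line \<open>y = 0\<close> and makes both leading forms of \<open>F\<close> and \<open>F + G\<close> pure powers
  of \<open>x\<close>. The cofactors \<open>A - Q U\<close> and \<open>B - Q V\<close> satisfy the degree bound, and the coefficient in
  question equals \<open>deg R\<close>. Hence \<open>R\<close> is linear in \<open>x\<close> for every fibre: each fibre has exactly one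
  point, and its coordinates depend polynomially on the target since the leading coefficient of
  \<open>R\<close>, as a polynomial in the target, has no zero and is therefore constant.
\<close>

section \<open>Norms modulo a monic polynomial\<close>

text \<open>Pseudo-division scales the dividend by a power of the leading coefficient. Here that
  power is 1, so it is honest division with remainder over any integral domain.\<close>

lemma pseudo_mod_monic:
  fixes F :: "'a::idom poly"
  assumes "lead_coeff F = 1"
  obtains q where "p = F * q + pseudo_mod p F"
proof -
  have F: "F \<noteq> 0" using assms by auto
  obtain q r where qr: "pseudo_divmod p F = (q, r)" by force
  from pseudo_divmod(1)[OF F qr] assms have "p = F * q + r" by simp
  with qr have "p = F * q + pseudo_mod p F" by (simp add: pseudo_mod_def)
  then show thesis by (rule that)
qed

lemma pseudo_mod_degree_lt:
  fixes F :: "'a::idom poly"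
  assumes "degree F > 0"
  shows "degree (pseudo_mod p F) < degree F"
  using pseudo_mod(2)[of F p] assms by fastforce

lemma pseudo_mod_unique:
  fixes F :: "'a::idom poly"
  assumes F: "lead_coeff F = 1" "degree F > 0" and p: "p = F * q + r" and r: "degree r < degree F"
  shows "pseudo_mod p F = r"
proof -
  obtain q' where q': "p = F * q' + pseudo_mod p F" using F(1) by (rule pseudo_mod_monic)
  let ?r = "pseudo_mod p F"
  have eq: "F * (q - q') = ?r - r" using p q' by (simp add: algebra_simps)
  have deg: "degree (?r - r) < degree F"
    using pseudo_mod_degree_lt[OF F(2), of p] r by (intro degree_diff_less) auto
  have "q - q' = 0"
  proof (rule ccontr)
    assume "q - q' \<noteq> 0"
    then have "degree (F * (q - q')) \<ge> degree F"
      using F by (subst degree_mult_eq) auto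
    with eq deg show False by simp
  qed
  with eq show ?thesis by simp
qed

lemma degree_map_poly_monic:
  fixes F :: "'a::idom poly" and hom :: "'a \<Rightarrow> 'b::idom"
  assumes "comm_ring_hom hom" "lead_coeff F = 1"
  shows "degree (map_poly hom F) = degree F" "lead_coeff (map_poly hom F) = 1"
proof -
  interpret comm_ring_hom hom by fact
  show "degree (map_poly hom F) = degree F" using assms(2) by (intro degree_map_poly) auto
  then show "lead_coeff (map_poly hom F) = 1" using assms(2) by (simp add: coeff_map_poly)
qed

text \<open>The image of a division by \<open>F\<close> is again a division by a monic polynomial of
  the same degree, and remainders are unique.\<close>

lemma pseudo_mod_hom:
  fixes F :: "'a::idom poly" and hom :: "'a \<Rightarrow> 'b::idom"
  assumes hom: "comm_ring_hom hom" and F: "lead_coeff F = 1" "degree F > 0"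
  shows "pseudo_mod (map_poly hom p) (map_poly hom F) = map_poly hom (pseudo_mod p F)"
proof -
  interpret comm_ring_hom hom by fact
  interpret h: map_poly_comm_ring_hom hom ..
  obtain q where q: "p = F * q + pseudo_mod p F" using F(1) by (rule pseudo_mod_monic)
  have "map_poly hom p = map_poly hom F * map_poly hom q + map_poly hom (pseudo_mod p F)"
    by (subst q) (simp add: hom_distribs)
  then show ?thesis
  proof (rule pseudo_mod_unique[rotated 2])
    show "degree (map_poly hom (pseudo_mod p F)) < degree (map_poly hom F)"
      using degree_map_poly_le[of hom "pseudo_mod p F"] pseudo_mod_degree_lt[OF F(2), of p]
      by (simp add: degree_map_poly_monic[OF hom F(1)])
  qed (use F degree_map_poly_monic[OF hom F(1)] in auto)
qed

text \<open>
  The rows of \<open>mult_mat F G\<close> represent multiplication by \<open>G\<close> on \<open>A[y]/(F)\<close> in the basis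
  \<open>1, y, \<dots>\<close>; so \<open>poly_norm F G\<close> is the norm of \<open>G\<close>. Unlike the Sylvester determinant,
  it commutes with every ring homomorphism for monic \<open>F\<close>, even if the degree
  of \<open>G\<close> drops.
\<close>

definition mult_mat :: "'a::idom poly \<Rightarrow> 'a poly \<Rightarrow> 'a mat" where
  "mult_mat F G = mat (degree F) (degree F) (\<lambda>(i, k). coeff (pseudo_mod (monom 1 i * G) F) k)"

definition poly_norm :: "'a::idom poly \<Rightarrow> 'a poly \<Rightarrow> 'a" where
  "poly_norm F G = det (mult_mat F G)"

lemma dim_mult_mat [simp]: "dim_row (mult_mat F G) = degree F" "dim_col (mult_mat F G) = degree F"
  by (simp_all add: mult_mat_def)

lemma mult_mat_carrier [simp]: "mult_mat F G \<in> carrier_mat (degree F) (degree F)"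
  by (simp add: mult_mat_def)

lemma poly_norm_hom:
  fixes F :: "'a::idom poly" and hom :: "'a \<Rightarrow> 'b::idom"
  assumes hom: "comm_ring_hom hom" and F: "lead_coeff F = 1" "degree F > 0"
  shows "poly_norm (map_poly hom F) (map_poly hom G) = hom (poly_norm F G)"
proof -
  interpret comm_ring_hom hom by fact
  interpret h: map_poly_comm_ring_hom hom ..
  have "mult_mat (map_poly hom F) (map_poly hom G) = map_mat hom (mult_mat F G)"
  proof (rule eq_matI)
    fix i j
    assume ij: "i < dim_row (map_mat hom (mult_mat F G))" "j < dim_col (map_mat hom (mult_mat F G))"
    have "monom 1 i * map_poly hom G = map_poly hom (monom 1 i * G)"
      by (simp add: hom_distribs)
    then show "mult_mat (map_poly hom F) (map_poly hom G) $$ (i, j) = map_mat hom (mult_mat F G) $$ (i, j)"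
      using ij pseudo_mod_hom[OF hom F, of "monom 1 i * G"]
      by (simp add: mult_mat_def degree_map_poly_monic[OF hom F(1)] coeff_map_poly)
  qed (simp_all add: mult_mat_def degree_map_poly_monic[OF hom F(1)])
  then show ?thesis by (simp add: poly_norm_def)
qed

lemma poly_as_sum_less:
  assumes "degree p < n"
  shows "p = (\<Sum>i<n. monom (coeff p i) i)"
proof (rule poly_eqI)
  fix k
  show "coeff p k = coeff (\<Sum>i<n. monom (coeff p i) i) k"
    using assms by (cases "k < n") (auto simp: coeff_sum coeff_eq_0)
qed

text \<open>Translates row vectors into polynomials: multiplying \<open>c\<close> into the matrix
  from the left is multiplying the polynomial with coefficients \<open>c\<close> by \<open>G\<close>
  modulo \<open>F\<close>.\<close>

lemma vec_mult_mat:
  fixes F G :: "'a::idom poly"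
  assumes F: "lead_coeff F = 1" "degree F > 0"
    and c: "\<And>l. l < degree F \<Longrightarrow> (\<Sum>k<degree F. c k * mult_mat F G $$ (k, l)) = coeff r l"
    and r: "degree r < degree F"
  shows "\<exists>q. (\<Sum>k<degree F. monom (c k) k) * G = F * q + r"
proof -
  let ?d = "degree F"
  have "\<exists>q. monom 1 k * G = F * q + pseudo_mod (monom 1 k * G) F" for k
    using pseudo_mod_monic[OF F(1)] by metis
  then obtain q where q: "\<And>k. monom 1 k * G = F * q k + pseudo_mod (monom 1 k * G) F" by metis
  have "(\<Sum>k<?d. Polynomial.smult (c k) (pseudo_mod (monom 1 k * G) F)) = r"
  proof (rule poly_eqI)
    fix l
    have "coeff (pseudo_mod (monom 1 k * G) F) l = 0" if "l \<ge> ?d" for k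
      using pseudo_mod_degree_lt[OF F(2), of "monom 1 k * G"] that by (intro coeff_eq_0) auto
    then show "coeff (\<Sum>k<?d. Polynomial.smult (c k) (pseudo_mod (monom 1 k * G) F)) l = coeff r l"
      using c[of l] r by (cases "l < ?d") (auto simp: coeff_sum mult_mat_def coeff_eq_0)
  qed
  moreover have "(\<Sum>k<?d. monom (c k) k) * G = (\<Sum>k<?d. Polynomial.smult (c k) (monom 1 k * G))"
    by (simp add: sum_distrib_right smult_monom flip: mult_smult_left)
  moreover have "(\<Sum>k<?d. Polynomial.smult (c k) (monom 1 k * G)) =
      (\<Sum>k<?d. F * Polynomial.smult (c k) (q k) + Polynomial.smult (c k) (pseudo_mod (monom 1 k * G) F))"
  proof (rule sum.cong[OF refl])
    fix k
    have "Polynomial.smult (c k) (monom 1 k * G) = Polynomial.smult (c k) (F * q k + pseudo_mod (monom 1 k * G) F)"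
      using q[of k] by (rule arg_cong)
    then show "Polynomial.smult (c k) (monom 1 k * G) =
        F * Polynomial.smult (c k) (q k) + Polynomial.smult (c k) (pseudo_mod (monom 1 k * G) F)"
      by (simp add: smult_add_right)
  qed
  ultimately have "(\<Sum>k<?d. monom (c k) k) * G = F * (\<Sum>k<?d. Polynomial.smult (c k) (q k)) + r"
    by (simp add: sum.distrib sum_distrib_left)
  then show ?thesis by blast
qed

lemma degree_sum_monom_less: "n > 0 \<Longrightarrow> degree (\<Sum>k<n. monom (c k) k) < n"
  by (rule degree_lessI) (auto simp: coeff_sum)

text \<open>The first row of the adjugate times the matrix is the determinant times the first unit
  vector. With that row as the coefficients of \<open>V\<close>, this says that \<open>V * G\<close>
  is congruent to the norm modulo \<open>F\<close>.\<close>

lemma poly_norm_bezout: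
  fixes F G :: "'a::idom poly"
  assumes F: "lead_coeff F = 1" "degree F > 0"
  obtains U V where "[:poly_norm F G:] = U * F + V * G" "degree V < degree F"
proof -
  let ?d = "degree F" and ?M = "mult_mat F G"
  define c where "c k = adj_mat ?M $$ (0, k)" for k
  have "(\<Sum>k<?d. c k * ?M $$ (k, l)) = coeff [:poly_norm F G:] l" if l: "l < ?d" for l
  proof -
    have "(adj_mat ?M * ?M) $$ (0, l) = (\<Sum>k<?d. c k * ?M $$ (k, l))"
      using F(2) l adj_mat(1)[OF mult_mat_carrier[of F G]]
      by (auto simp: c_def scalar_prod_def lessThan_atLeast0)
    moreover have "(adj_mat ?M * ?M) $$ (0, l) = coeff [:poly_norm F G:] l"
      using F(2) l unfolding adj_mat(3)[OF mult_mat_carrier[of F G]]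
      by (cases l) (auto simp: poly_norm_def)
    ultimately show ?thesis by simp
  qed
  then obtain q where "(\<Sum>k<?d. monom (c k) k) * G = F * q + [:poly_norm F G:]"
    using vec_mult_mat[OF F, of c G "[:poly_norm F G:]"] F(2) by (auto simp: degree_pCons_eq_if)
  then have "[:poly_norm F G:] = (- q) * F + (\<Sum>k<?d. monom (c k) k) * G"
    by (simp add: algebra_simps)
  then show thesis using that degree_sum_monom_less[OF F(2)] by blast
qed

text \<open>A singular matrix has a nonzero left kernel vector, that is, a nonzero polynomial of
  degree below \<open>degree F\<close> whose product with \<open>G\<close> is divisible by
  \<open>F\<close>. Coprimality forbids this.\<close>

lemma poly_norm_nonzero:
  fixes F G :: "'a::{factorial_ring_gcd,semiring_gcd_mult_normalize} poly"
  assumes F: "lead_coeff F = 1" "degree F > 0" and cop: "coprime F G"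
  shows "poly_norm F G \<noteq> 0"
proof
  let ?d = "degree F" and ?M = "mult_mat F G"
  assume "poly_norm F G = 0"
  then have "det (transpose_mat ?M) = 0"
    by (simp add: poly_norm_def det_transpose[OF mult_mat_carrier])
  then obtain v where v: "v \<in> carrier_vec ?d" "v \<noteq> 0\<^sub>v ?d" "transpose_mat ?M *\<^sub>v v = 0\<^sub>v ?d"
    using det_0_iff_vec_prod_zero[of "transpose_mat ?M" ?d] by auto
  have "(\<Sum>k<?d. v $ k * ?M $$ (k, l)) = coeff 0 l" if "l < ?d" for l
  proof -
    have "(transpose_mat ?M *\<^sub>v v) $ l = (\<Sum>k<?d. v $ k * ?M $$ (k, l))"
      using that v(1) by (auto simp: scalar_prod_def lessThan_atLeast0 mult.commute intro!: sum.cong)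
    with v(3) that show ?thesis by simp
  qed
  then obtain q where "(\<Sum>k<?d. monom (v $ k) k) * G = F * q + 0"
    using vec_mult_mat[OF F, of "\<lambda>k. v $ k" G 0] F(2) by auto
  then have "F dvd (\<Sum>k<?d. monom (v $ k) k) * G" by simp
  then have dvd: "F dvd (\<Sum>k<?d. monom (v $ k) k)"
    using cop by (simp add: coprime_dvd_mult_left_iff)
  have "(\<Sum>k<?d. monom (v $ k) k) = 0"
    using dvd_imp_degree_le[OF dvd] degree_sum_monom_less[OF F(2), of "\<lambda>k. v $ k"] by force
  moreover have "coeff (\<Sum>k<?d. monom (v $ k) k) i = v $ i" if "i < ?d" for i
    using that by (simp add: coeff_sum)
  ultimately have "v = 0\<^sub>v ?d" using v(1) by (intro eq_vecI) auto
  with v(2) show False ..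
qed

section \<open>First-order expansion of the norm at the roots of a fibre\<close>

lemma dvd_prod_diff:
  fixes a b :: "'b \<Rightarrow> 'a::comm_ring_1"
  assumes "finite I" "\<And>i. i \<in> I \<Longrightarrow> z dvd a i - b i"
  shows "z dvd prod a I - prod b I"
  using assms
proof (induction I rule: finite_induct)
  case (insert i I)
  have "prod a (insert i I) - prod b (insert i I) = (a i - b i) * prod a I + b i * (prod a I - prod b I)"
    using insert.hyps by (simp add: algebra_simps)
  moreover have "z dvd a i - b i" "z dvd prod a I - prod b I" using insert by auto
  ultimately show ?case by (simp only: dvd_add dvd_mult dvd_mult2)
qed simp

text \<open>The Leibniz formula builds the determinant from sums and products, and both respect
  congruence modulo \<open>z\<close>.\<close>

lemma dvd_det_diff:
  fixes A B :: "'a::comm_ring_1 mat"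
  assumes A: "A \<in> carrier_mat n n" and B: "B \<in> carrier_mat n n"
    and z: "\<And>i j. i < n \<Longrightarrow> j < n \<Longrightarrow> z dvd A $$ (i, j) - B $$ (i, j)"
  shows "z dvd det A - det B"
proof -
  have "det A - det B = (\<Sum>p\<in>{p. p permutes {0..<n}}.
      signof p * ((\<Prod>i=0..<n. A $$ (i, p i)) - (\<Prod>i=0..<n. B $$ (i, p i))))"
    by (simp add: det_def'[OF A] det_def'[OF B] sum_subtractf right_diff_distrib)
  also have "z dvd \<dots>"
  proof (intro dvd_sum dvd_mult dvd_prod_diff z)
    fix p i assume "p \<in> {p. p permutes {0..<n}}" "i \<in> {0..<n}"
    then show "i < n" "p i < n" using permutes_in_image[of p "{0..<n}" i] by auto
  qed simp
  finally show ?thesis .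
qed

lemma monom_2_dvd:
  fixes q :: "complex poly"
  assumes "poly q 0 = 0" "poly (pderiv q) 0 = 0"
  shows "monom 1 2 dvd q"
  using assms by (auto simp: monom_1_dvd_iff' poly_0_coeff_0 coeff_pderiv numeral_2_eq_2 less_Suc_eq)

text \<open>Recentring at \<open>a\<close> turns first-order expansion at \<open>a\<close> into
  reduction modulo \<open>monom 1 2\<close>.\<close>

definition shift_poly :: "complex \<Rightarrow> complex poly \<Rightarrow> complex poly" where
  "shift_poly a p = pcompose p [:a, 1:]"

lemma comm_ring_hom_shift_poly: "comm_ring_hom (shift_poly a)"
  unfolding shift_poly_def by (rule pcompose_hom.comm_ring_hom_axioms)

lemma shift_poly_0 [simp]: "shift_poly a 0 = 0"
  by (simp add: shift_poly_def)

lemma poly_shift_poly_0 [simp]: "poly (shift_poly a p) 0 = poly p a"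
  and poly_pderiv_shift_poly_0 [simp]: "poly (pderiv (shift_poly a p)) 0 = poly (pderiv p) a"
  by (simp_all add: shift_poly_def poly_pcompose pderiv_pcompose pderiv_pCons)

lemma eval_xy_pCons [simp]: "eval_xy (pCons c p) a b = poly c a + b * eval_xy p a b"
  by (simp add: eval_xy_def)

lemma eval_xy_0 [simp]: "eval_xy 0 a b = 0"
  by (simp add: eval_xy_def)

lemma partial_x_pCons: "partial_x (pCons c p) = pCons (pderiv c) (partial_x p)"
  by (rule poly_eqI) (simp add: partial_x_def coeff_map_poly coeff_pCons split: nat.splits)

text \<open>The variable left after the substitution plays the role of \<epsilon>: this is the chain
  rule along the line \<open>(a + \<epsilon>, b + e \<epsilon>)\<close>.\<close>

lemma first_order_expansion:
  fixes p :: bpoly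
  shows "poly (poly (map_poly (shift_poly a) p) [:b, e:]) 0 = eval_xy p a b"
    and "poly (pderiv (poly (map_poly (shift_poly a) p) [:b, e:])) 0 = eval_xy (partial_x p) a b + e * eval_xy (partial_y p) a b"
proof (induction p)
  case 0
  { case 1 show ?case by simp
  next case 2 show ?case by (simp add: partial_x_def partial_y_def) }
next
  case (pCons c p)
  { case 1 from pCons show ?case by (simp add: map_poly_pCons)
  next case 2 from pCons show ?case
      by (simp add: map_poly_pCons pderiv_add pderiv_mult pderiv_smult pderiv_pCons partial_x_pCons partial_y_def algebra_simps) }
qed

text \<open>Substituting \<open>y\<close> into the division of \<open>monom 1 i * G\<close> by
  \<open>F\<close> shows that the powers of \<open>y\<close> form an eigenvector of
  \<open>mult_mat F G\<close> with eigenvalue \<open>poly G y\<close>, up to multiples of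
  \<open>poly F y\<close>. Approximate roots thus yield approximate eigenvectors.\<close>

lemma mult_mat_mult_power:
  fixes F G :: "'a::idom poly"
  assumes F: "lead_coeff F = 1" "degree F > 0" and i: "i < degree F"
  shows "poly F y dvd (\<Sum>k<degree F. mult_mat F G $$ (i, k) * y ^ k) - y ^ i * poly G y"
proof -
  obtain q where q: "monom 1 i * G = F * q + pseudo_mod (monom 1 i * G) F"
    using F(1) by (rule pseudo_mod_monic)
  have "pseudo_mod (monom 1 i * G) F = (\<Sum>k<degree F. monom (mult_mat F G $$ (i, k)) k)"
    using poly_as_sum_less[OF pseudo_mod_degree_lt[OF F(2)], of "monom 1 i * G"] i
    by (simp add: mult_mat_def)
  then have "poly (pseudo_mod (monom 1 i * G) F) y = (\<Sum>k<degree F. mult_mat F G $$ (i, k) * y ^ k)"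
    by (simp add: poly_sum poly_monom)
  moreover have "y ^ i * poly G y = poly F y * poly q y + poly (pseudo_mod (monom 1 i * G) F) y"
    using arg_cong[OF q, of "\<lambda>p. poly p y"] by (simp add: poly_monom)
  ultimately show ?thesis by simp
qed

text \<open>A left kernel vector would give the coefficients of a nonzero polynomial of degree below
  \<open>n\<close> with \<open>n\<close> distinct roots.\<close>

lemma det_vandermonde_nonzero:
  fixes y :: "nat \<Rightarrow> complex"
  assumes "n > 0" and y: "inj_on y {..<n}"
  shows "det (mat n n (\<lambda>(i, j). y j ^ i)) \<noteq> 0"
proof
  let ?P = "mat n n (\<lambda>(i, j). y j ^ i)"
  assume "det ?P = 0"
  then have "det (transpose_mat ?P) = 0" by (simp add: det_transpose[of _ n])
  then obtain v where v: "v \<in> carrier_vec n" "v \<noteq> 0\<^sub>v n" "transpose_mat ?P *\<^sub>v v = 0\<^sub>v n"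
    using det_0_iff_vec_prod_zero[of "transpose_mat ?P" n] by auto
  define p where "p = (\<Sum>k<n. monom (v $ k) k)"
  have "poly p (y j) = 0" if "j < n" for j
  proof -
    have "(transpose_mat ?P *\<^sub>v v) $ j = poly p (y j)"
      using that v(1) by (auto simp: p_def poly_sum poly_monom scalar_prod_def lessThan_atLeast0 mult.commute intro!: sum.cong)
    with v(3) that show ?thesis by simp
  qed
  then have "p = 0"
    using degree_sum_monom_less[OF assms(1), of "\<lambda>k. v $ k"] y
    by (intro poly_eqI_degree[of "y ` {..<n}"]) (auto simp: card_image p_def)
  moreover have "coeff p i = v $ i" if "i < n" for i
    using that by (simp add: p_def coeff_sum)
  ultimately have "v = 0\<^sub>v n" using v(1) by (intro eq_vecI) auto
  with v(2) show False ..
qed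

text \<open>
  Moving the roots \<open>y\<^sub>i\<close> to \<open>y\<^sub>i + e\<^sub>i \<epsilon>\<close> keeps them roots of \<open>F\<close> at \<open>a + \<epsilon>\<close> modulo \<open>\<epsilon>\<^sup>2\<close>, so
  the Vandermonde matrix still diagonalises multiplication by \<open>G\<close> to first order. Comparing
  determinants modulo \<open>\<epsilon>\<^sup>2\<close> gives the norm together with its derivative.
\<close>

lemma poly_norm_at_roots:
  fixes F G :: bpoly and y :: "nat \<Rightarrow> complex"
  assumes F: "lead_coeff F = 1" "degree F > 0"
    and y: "inj_on y {..<degree F}"
    and root: "\<And>i. i < degree F \<Longrightarrow> eval_xy F a (y i) = 0"
    and e: "\<And>i. i < degree F \<Longrightarrow> eval_xy (partial_x F) a (y i) + e i * eval_xy (partial_y F) a (y i) = 0"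
  shows "poly (poly_norm F G) a = (\<Prod>i<degree F. eval_xy G a (y i))"
    and "poly (pderiv (poly_norm F G)) a = (\<Sum>i<degree F.
           (eval_xy (partial_x G) a (y i) + e i * eval_xy (partial_y G) a (y i)) *
           (\<Prod>j\<in>{..<degree F} - {i}. eval_xy G a (y j)))"
proof -
  let ?d = "degree F" and ?h = "shift_poly a"
  define z :: "nat \<Rightarrow> complex poly" where "z i = [:y i, e i:]" for i
  define g where "g i = poly (map_poly ?h G) (z i)" for i
  define P where "P = mat ?d ?d (\<lambda>(i, j). z j ^ i)"
  define D where "D = mat ?d ?d (\<lambda>(i, j). if i = j then g i else 0)"
  define M where "M = mult_mat (map_poly ?h F) (map_poly ?h G)"
  note hom = comm_ring_hom_shift_poly[of a]
  have deg: "degree (map_poly ?h F) = ?d" "lead_coeff (map_poly ?h F) = 1"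
    using degree_map_poly_monic[OF hom F(1)] by simp_all
  have carr: "P \<in> carrier_mat ?d ?d" "D \<in> carrier_mat ?d ?d" "M \<in> carrier_mat ?d ?d"
    using mult_mat_carrier[of "map_poly ?h F" "map_poly ?h G"] by (simp_all add: P_def D_def M_def deg)
  have "monom 1 2 dvd det (M * P) - det (P * D)"
  proof (rule dvd_det_diff)
    fix i j assume i: "i < ?d" and j: "j < ?d"
    have "monom 1 2 dvd poly (map_poly ?h F) (z j)"
      unfolding z_def using root[OF j] e[OF j] by (intro monom_2_dvd) (simp_all add: first_order_expansion)
    moreover have "poly (map_poly ?h F) (z j) dvd (\<Sum>k<?d. M $$ (i, k) * z j ^ k) - z j ^ i * g j"
      using mult_mat_mult_power[of "map_poly ?h F" i "z j" "map_poly ?h G"] deg F(2) i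
      by (simp add: M_def g_def)
    moreover have "(M * P) $$ (i, j) = (\<Sum>k<?d. M $$ (i, k) * z j ^ k)"
      using i j carr by (auto simp: scalar_prod_def P_def lessThan_atLeast0)
    moreover have "(P * D) $$ (i, j) = z j ^ i * g j"
      using i j carr by (auto simp: scalar_prod_def P_def D_def if_distrib[of "(*) _"] cong: if_cong)
    ultimately show "monom 1 2 dvd (M * P) $$ (i, j) - (P * D) $$ (i, j)"
      by (metis dvd_trans)
  qed (use carr in auto)
  moreover have "det D = prod g {..<?d}"
    using carr det_upper_triangular[of D ?d]
    by (auto simp: D_def upper_triangular_def prod_list_diag_prod lessThan_atLeast0)
  moreover have "det M = ?h (poly_norm F G)"
    using poly_norm_hom[OF hom F, of G] by (simp add: M_def poly_norm_def)
  ultimately have "monom 1 2 dvd det P * (?h (poly_norm F G) - prod g {..<?d})"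
    using carr by (simp add: det_mult algebra_simps)
  then obtain r where r: "det P * (?h (poly_norm F G) - prod g {..<?d}) = monom 1 2 * r" ..
  have "map_mat (\<lambda>p. poly p 0) P = mat ?d ?d (\<lambda>(i, j). y j ^ i)"
    by (intro eq_matI) (auto simp: P_def z_def)
  then have P0: "poly (det P) 0 \<noteq> 0"
    using det_vandermonde_nonzero[OF F(2) y] comm_ring_hom.hom_det[OF poly_hom.comm_ring_hom_axioms, of 0 P] by simp
  \<comment> \<open>At \<epsilon> = 0 the matrix \<open>P\<close> is an ordinary Vandermonde matrix,
    so \<open>det P\<close> can be cancelled modulo \<open>monom 1 2\<close>: both \<open>w\<close>
    and its derivative vanish at 0.\<close>
  define w where "w = ?h (poly_norm F G) - prod g {..<?d}"
  have w: "det P * w = monom 1 2 * r" using r by (simp add: w_def)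
  have "poly (det P * w) 0 = 0" by (simp add: w poly_monom)
  with P0 have w0: "poly w 0 = 0" by simp
  have "poly (pderiv (det P * w)) 0 = 0"
    by (simp add: w pderiv_mult poly_monom pderiv_monom)
  with P0 w0 have w1: "poly (pderiv w) 0 = 0" by (simp add: pderiv_mult)
  have g0: "poly (g i) 0 = eval_xy G a (y i)"
    and g1: "poly (pderiv (g i)) 0 = eval_xy (partial_x G) a (y i) + e i * eval_xy (partial_y G) a (y i)" for i
    unfolding g_def z_def by (rule first_order_expansion)+
  show "poly (poly_norm F G) a = (\<Prod>i<?d. eval_xy G a (y i))"
    using w0 by (simp add: w_def poly_prod g0)
  show "poly (pderiv (poly_norm F G)) a = (\<Sum>i<?d.
           (eval_xy (partial_x G) a (y i) + e i * eval_xy (partial_y G) a (y i)) *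
           (\<Prod>j\<in>{..<?d} - {i}. eval_xy G a (y j)))"
    using w1 by (simp add: w_def pderiv_diff pderiv_prod poly_sum poly_prod g0 g1 mult.commute)
qed

section \<open>The Jacobian condition and the Bezout cofactor\<close>

lemma eval_xy_1 [simp]: "eval_xy 1 a b = 1"
  and eval_xy_diff [simp]: "eval_xy (p - q) a b = eval_xy p a b - eval_xy q a b"
  and eval_xy_power [simp]: "eval_xy (p ^ n) a b = eval_xy p a b ^ n"
  by (simp_all add: eval_xy_def)

lemma partial_x_0 [simp]: "partial_x 0 = 0"
  and partial_y_0 [simp]: "partial_y 0 = 0"
  and partial_x_add: "partial_x (p + q) = partial_x p + partial_x q"
  and partial_y_add: "partial_y (p + q) = partial_y p + partial_y q"
  and partial_x_diff: "partial_x (p - q) = partial_x p - partial_x q"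
  and partial_y_diff: "partial_y (p - q) = partial_y p - partial_y q"
  by (auto simp: partial_x_def partial_y_def coeff_map_poly pderiv_add pderiv_diff intro!: poly_eqI)

lemma partial_y_mult: "partial_y (p * q) = partial_y p * q + p * partial_y q"
  by (simp add: partial_y_def pderiv_mult algebra_simps)

lemma partial_x_mult: "partial_x (p * q) = partial_x p * q + p * partial_x q"
proof (rule poly_eqI)
  fix n
  have "coeff (partial_x (p * q)) n =
      (\<Sum>i\<le>n. coeff p i * pderiv (coeff q (n - i)) + coeff q (n - i) * pderiv (coeff p i))"
    by (simp add: partial_x_def coeff_map_poly coeff_mult pderiv_sum pderiv_mult)
  also have "\<dots> = (\<Sum>i\<le>n. pderiv (coeff p i) * coeff q (n - i) + coeff p i * pderiv (coeff q (n - i)))"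
    by (intro sum.cong refl) (simp only: add.commute mult.commute)
  finally show "coeff (partial_x (p * q)) n = coeff (partial_x p * q + p * partial_x q) n"
    by (simp add: partial_x_def coeff_map_poly coeff_mult sum.distrib)
qed

section \<open>Restriction to vertical lines and coprimality for Jacobian pairs\<close>

definition slice :: "complex \<Rightarrow> bpoly \<Rightarrow> complex poly" where
  "slice a p = map_poly (\<lambda>q. poly q a) p"

lemma coeff_slice: "coeff (slice a p) k = poly (coeff p k) a"
  by (simp add: slice_def coeff_map_poly)

lemma poly_slice [simp]: "poly (slice a p) b = eval_xy p a b"
  by (induction p) (simp_all add: slice_def map_poly_pCons)

lemma slice_monic:
  assumes "lead_coeff p = 1"
  shows "degree (slice a p) = degree p" "lead_coeff (slice a p) = 1"
  unfolding slice_def using degree_map_poly_monic[OF poly_hom.comm_ring_hom_axioms assms] by simp_all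

lemma pderiv_slice: "pderiv (slice a p) = slice a (partial_y p)"
  by (rule poly_eqI) (simp add: coeff_slice coeff_pderiv partial_y_def of_nat_poly)

text \<open>The leading coefficient of a divisor of a monic polynomial is a unit, hence a nonzero
  constant. So the degree in \<open>y\<close> survives restriction to every vertical line, and the
  fundamental theorem of algebra supplies a zero there.\<close>

lemma monic_divisor_zero:
  assumes F: "lead_coeff F = 1" and g: "g dvd F" "\<not> is_unit g"
  shows "degree g > 0" and "\<exists>b. eval_xy g a b = 0"
proof -
  obtain h where h: "F = g * h" using g(1) ..
  have "lead_coeff g * lead_coeff h = 1" using F by (simp add: h lead_coeff_mult)
  then have "is_unit (lead_coeff g)" by (metis dvd_triv_left)
  then have "lead_coeff g \<noteq> 0" "degree (lead_coeff g) = 0" by (auto simp: is_unit_iff_degree)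
  then obtain c where c: "lead_coeff g = [:c:]" "c \<noteq> 0" by (metis degree_eq_zeroE pCons_0_0)
  show deg: "degree g > 0"
  proof (rule ccontr)
    assume "\<not> degree g > 0"
    then have "g = [:[:c:]:]" using c(1) degree_0_id[of g] by simp
    with g(2) c(2) show False by (simp add: is_unit_const_poly_iff)
  qed
  have "coeff (slice a g) (degree g) = c" using c(1) by (simp add: coeff_slice)
  then have "degree (slice a g) \<ge> degree g" using c(2) by (intro le_degree) simp
  with deg have "\<not> constant (poly (slice a g))" by (simp add: constant_degree)
  then show "\<exists>b. eval_xy g a b = 0" using fundamental_theorem_of_algebra by fastforce
qed

lemma eval_jacobian:
  assumes "jacobian (f, g) = 1"
  shows "eval_xy (partial_x f) a b * eval_xy (partial_y g) a b
       - eval_xy (partial_y f) a b * eval_xy (partial_x g) a b = 1"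
  using arg_cong[OF assms, of "\<lambda>p. eval_xy p a b"] by (simp add: jacobian_def)

text \<open>At a zero of a common factor both gradients are multiples of the gradient of that
  factor, so the Jacobian would vanish.\<close>

lemma jacobian_coprime:
  assumes F: "lead_coeff F = 1" and J: "jacobian (F, G) = 1"
  shows "coprime F G"
proof (rule coprimeI)
  fix c assume c: "c dvd F" "c dvd G"
  show "is_unit c"
  proof (rule ccontr)
    assume "\<not> is_unit c"
    then obtain b where b: "eval_xy c 0 b = 0" using monic_divisor_zero(2)[OF F c(1)] by blast
    from c obtain u v where uv: "F = c * u" "G = c * v" by (auto elim!: dvdE)
    from eval_jacobian[OF J, of 0 b] b show False
      by (simp add: uv partial_x_mult partial_y_mult)
  qed
qed

text \<open>A common prime factor \<open>p\<close> cannot divide its own \<open>y\<close>-derivative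
  for degree reasons, so its square divides \<open>F\<close>. Then both partial derivatives of
  \<open>F\<close> vanish at a zero of \<open>p\<close>, against the Jacobian condition.\<close>

lemma jacobian_separable:
  assumes F: "lead_coeff F = 1" and J: "jacobian (F, G) = 1"
  shows "coprime F (partial_y F)"
proof (rule ccontr)
  assume "\<not> coprime F (partial_y F)"
  then obtain c where c: "c dvd F" "c dvd partial_y F" "\<not> is_unit c" by (auto simp: coprime_def)
  have "c \<noteq> 0" using c(1) F by auto
  then obtain p where p: "p dvd c" "prime p" using prime_divisor_exists c(3) by blast
  have pF: "p dvd F" "p dvd partial_y F" using p c by (auto intro: dvd_trans)
  have unit: "\<not> is_unit p" using p(2) by auto
  obtain h where h: "F = p * h" using pF(1) ..
  have deg: "degree p > 0" using monic_divisor_zero(1)[OF F pF(1) unit] .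
  have "p dvd partial_y p * h + p * partial_y h"
    using pF(2) by (simp add: h partial_y_mult)
  then have "p dvd partial_y p * h" by (simp add: dvd_add_left_iff)
  then have "p dvd partial_y p \<or> p dvd h" using p(2) by (simp add: prime_dvd_mult_iff)
  moreover have "\<not> p dvd partial_y p"
  proof
    assume *: "p dvd partial_y p"
    have "partial_y p \<noteq> 0" using deg by (simp add: partial_y_def pderiv_eq_0_iff)
    with * have "degree p \<le> degree (partial_y p)" by (rule dvd_imp_degree_le)
    with deg show False by (simp add: partial_y_def degree_pderiv)
  qed
  ultimately obtain k where k: "h = p * k" by auto
  obtain b where b: "eval_xy p 0 b = 0" using monic_divisor_zero(2)[OF F pF(1) unit] by blast
  from eval_jacobian[OF J, of 0 b] b show False
    by (simp add: h k partial_x_mult partial_y_mult)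
qed

text \<open>Each Lagrange basis polynomial is a product of \<open>d - 1\<close> monic linear factors
  divided by the value of that product at its own node, so its top coefficient is the inverse of
  that value.\<close>

lemma lagrange_top_coeff:
  fixes y :: "nat \<Rightarrow> 'a::field"
  assumes d: "d > 0" and y: "inj_on y {..<d}" and v: "degree v < d"
  shows "coeff v (d - 1) = (\<Sum>i<d. poly v (y i) / (\<Prod>j\<in>{..<d} - {i}. y i - y j))"
proof -
  define l where "l i = (\<Prod>j\<in>{..<d} - {i}. [:- y j, 1:])" for i
  define c where "c i = poly v (y i) / (\<Prod>j\<in>{..<d} - {i}. y i - y j)" for i
  have degl: "degree (l i) = d - 1" if "i < d" for i
    unfolding l_def using that by (subst degree_prod_eq_sum_degree) auto
  have monic: "lead_coeff (l i) = 1" for i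
    by (simp add: l_def lead_coeff_prod)
  have pl: "poly (l i) (y k) = (if i = k then \<Prod>j\<in>{..<d} - {i}. y i - y j else 0)" if "i < d" "k < d" for i k
    using that by (auto simp: l_def poly_prod)
  have nz: "(\<Prod>j\<in>{..<d} - {i}. y i - y j) \<noteq> 0" if "i < d" for i
    using that y by (auto simp: inj_on_def)
  have "v = (\<Sum>i<d. Polynomial.smult (c i) (l i))"
  proof (rule poly_eqI_degree[of "y ` {..<d}"])
    fix x assume "x \<in> y ` {..<d}"
    then obtain k where k: "k < d" "x = y k" by auto
    have "poly (\<Sum>i<d. Polynomial.smult (c i) (l i)) x = (\<Sum>i<d. if i = k then poly v (y k) else 0)"
      unfolding poly_sum k(2) using k(1) nz pl by (intro sum.cong) (auto simp: c_def)
    then show "poly v x = poly (\<Sum>i<d. Polynomial.smult (c i) (l i)) x" using k by simp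
  next
    have "degree (\<Sum>i<d. Polynomial.smult (c i) (l i)) < d"
      using d degl by (intro degree_sum_less) (auto intro: le_less_trans[OF degree_smult_le])
    then show "degree (\<Sum>i<d. Polynomial.smult (c i) (l i)) < card (y ` {..<d})"
      using y by (simp add: card_image)
  qed (use v y in \<open>simp add: card_image\<close>)
  from arg_cong[OF this, of "\<lambda>p. coeff p (d - 1)"]
  have "coeff v (d - 1) = (\<Sum>i<d. c i * coeff (l i) (d - 1))"
    by (simp add: coeff_sum)
  also have "\<dots> = (\<Sum>i<d. c i)"
  proof (intro sum.cong refl)
    fix i assume "i \<in> {..<d}"
    then show "c i * coeff (l i) (d - 1) = c i" using degl[of i] monic[of i] by simp
  qed
  finally show ?thesis by (simp add: c_def)
qed

text \<open>
  Over a general \<open>x\<close>-coordinate, Lagrange interpolation writes the top coefficient of \<open>V\<close> as the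
  sum of \<open>R / (G F\<^sub>y)\<close> over the roots of \<open>F\<close>. By the Jacobian condition \<open>- 1 / F\<^sub>y\<close> is the derivative
  of \<open>G\<close> along the curve \<open>F = 0\<close>, so this sum is minus the logarithmic derivative of the norm times
  the norm.
\<close>

lemma bezout_top_coeff:
  fixes F G :: bpoly
  assumes F: "lead_coeff F = 1" "degree F > 0" and J: "jacobian (F, G) = 1"
    and UV: "[:poly_norm F G:] = U * F + V * G" "degree V < degree F"
  shows "coeff V (degree F - 1) = - pderiv (poly_norm F G)"
proof -
  let ?d = "degree F" and ?R = "poly_norm F G"
  \<comment> \<open>Up to sign \<open>S\<close> is the discriminant of \<open>F\<close>; where it
    does not vanish, \<open>F\<close> has \<open>degree F\<close> distinct roots on the vertical
    line.\<close>
  define S where "S = poly_norm F (partial_y F)"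
  have R0: "?R \<noteq> 0" using poly_norm_nonzero[OF F jacobian_coprime[OF F(1) J]] .
  have S0: "S \<noteq> 0" unfolding S_def using poly_norm_nonzero[OF F jacobian_separable[OF F(1) J]] .
  obtain A B where AB: "[:S:] = A * F + B * partial_y F"
    using poly_norm_bezout[OF F, of "partial_y F"] unfolding S_def by blast
  have "poly (coeff V (?d - 1)) a = - poly (pderiv ?R) a" if a: "poly S a \<noteq> 0" "poly ?R a \<noteq> 0" for a
  proof -
    define f where "f = slice a F"
    have f: "degree f = ?d" "lead_coeff f = 1" using slice_monic[OF F(1)] by (simp_all add: f_def)
    have sep: "eval_xy (partial_y F) a b \<noteq> 0" if "eval_xy F a b = 0" for b
      using arg_cong[OF AB, of "\<lambda>p. eval_xy p a b"] that a(1) by auto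
    have "f \<noteq> 0" using f by auto
    moreover have "rsquarefree f"
      unfolding rsquarefree_roots using sep by (auto simp: f_def pderiv_slice)
    ultimately have card: "card {b. poly f b = 0} = ?d" using rsquarefree_card_degree f(1) by metis
    have fin: "finite {b. poly f b = 0}" using poly_roots_finite[OF \<open>f \<noteq> 0\<close>] .
    from ex_bij_betw_nat_finite[OF fin]
    obtain y where y: "bij_betw y {..<?d} {b. poly f b = 0}"
      unfolding card lessThan_atLeast0 by blast
    have inj: "inj_on y {..<?d}" using y by (rule bij_betw_imp_inj_on)
    have root: "eval_xy F a (y i) = 0" if "i < ?d" for i
      using bij_betwE[OF y] that by (auto simp: f_def)
    have fprod: "f = (\<Prod>j<?d. [:- y j, 1:])"
    proof (rule poly_eqI_degree_lead_coeff[of _ ?d _ "y ` {..<?d}"])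
      have "degree (\<Prod>j<?d. [:- y j, 1:]) = ?d" by (subst degree_prod_eq_sum_degree) auto
      moreover have "lead_coeff (\<Prod>j<?d. [:- y j, 1:]) = 1" by (simp add: lead_coeff_prod)
      ultimately show "degree (\<Prod>j<?d. [:- y j, 1:]) \<le> ?d"
        "coeff f ?d = coeff (\<Prod>j<?d. [:- y j, 1:]) ?d" using f by simp_all
      fix z assume "z \<in> y ` {..<?d}"
      then show "poly f z = poly (\<Prod>j<?d. [:- y j, 1:]) z" using root by (auto simp: f_def poly_prod)
    qed (use f inj in \<open>simp_all add: card_image\<close>)
    have fy: "eval_xy (partial_y F) a (y i) = (\<Prod>j\<in>{..<?d} - {i}. y i - y j)" if "i < ?d" for i
    proof -
      have "eval_xy (partial_y F) a (y i) = poly (pderiv f) (y i)" by (simp add: f_def pderiv_slice)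
      also have "\<dots> = (\<Sum>k<?d. (\<Prod>j\<in>{..<?d} - {k}. y i - y j))"
        by (subst fprod) (simp add: pderiv_prod poly_sum poly_prod pderiv_pCons)
      also have "\<dots> = (\<Sum>k<?d. if k = i then (\<Prod>j\<in>{..<?d} - {i}. y i - y j) else 0)"
        using that by (intro sum.cong) auto
      finally show ?thesis using that by simp
    qed
    define g where "g i = eval_xy G a (y i)" for i
    \<comment> \<open>The slope of the branch of \<open>F = 0\<close> through
      \<open>(a, y i)\<close>, by implicit differentiation.\<close>
    define e where "e i = - eval_xy (partial_x F) a (y i) / eval_xy (partial_y F) a (y i)" for i
    have e: "eval_xy (partial_x F) a (y i) + e i * eval_xy (partial_y F) a (y i) = 0" if "i < ?d" for i
      using sep[OF root[OF that]] by (simp add: e_def)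
    have norm: "poly ?R a = (\<Prod>i<?d. g i)"
      "poly (pderiv ?R) a = (\<Sum>i<?d. (eval_xy (partial_x G) a (y i) + e i * eval_xy (partial_y G) a (y i)) *
           (\<Prod>j\<in>{..<?d} - {i}. g j))"
      unfolding g_def using root e by (intro poly_norm_at_roots[OF F inj]; blast)+
    have prod: "poly ?R a = g i * (\<Prod>j\<in>{..<?d} - {i}. g j)" if "i < ?d" for i
      using that unfolding norm(1) by (intro prod.remove) auto
    have "degree (slice a V) < ?d" using UV(2) degree_map_poly_le[of "\<lambda>q. poly q a" V] unfolding slice_def by linarith
    then have "poly (coeff V (?d - 1)) a = (\<Sum>i<?d. eval_xy V a (y i) / eval_xy (partial_y F) a (y i))"
      using lagrange_top_coeff[OF F(2) inj, of "slice a V"] by (simp add: coeff_slice fy)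
    also have "\<dots> = (\<Sum>i<?d. - ((eval_xy (partial_x G) a (y i) + e i * eval_xy (partial_y G) a (y i)) *
           (\<Prod>j\<in>{..<?d} - {i}. g j)))"
    proof (intro sum.cong refl)
      fix i assume "i \<in> {..<?d}"
      then have i: "i < ?d" by simp
      note nz = sep[OF root[OF i]]
      have "poly ?R a = eval_xy V a (y i) * g i"
        using arg_cong[OF UV(1), of "\<lambda>p. eval_xy p a (y i)"] root[OF i] by (simp add: g_def)
      then have "eval_xy V a (y i) = (\<Prod>j\<in>{..<?d} - {i}. g j)"
        using prod[OF i] a(2) by auto
      moreover have "eval_xy (partial_x G) a (y i) + e i * eval_xy (partial_y G) a (y i) = - 1 / eval_xy (partial_y F) a (y i)"
        proof -
        have "c + (- a / b) * d = - 1 / b" if "a * d - b * c = 1" "b \<noteq> 0" for a b c d :: complex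
          using that by (simp add: divide_simps) (simp add: algebra_simps)
        from this[OF eval_jacobian[OF J, of a "y i"] nz] show ?thesis unfolding e_def .
      qed
      ultimately show "eval_xy V a (y i) / eval_xy (partial_y F) a (y i) =
          - ((eval_xy (partial_x G) a (y i) + e i * eval_xy (partial_y G) a (y i)) * (\<Prod>j\<in>{..<?d} - {i}. g j))"
        by simp
    qed
    also have "\<dots> = - poly (pderiv ?R) a" by (simp add: norm(2) sum_negf)
    finally show ?thesis .
  qed
  note * = this
  \<comment> \<open>The factor \<open>S * ?R\<close> covers the excluded \<open>a\<close>, so the
    product vanishes everywhere; being a nonzero polynomial, the factor can then be
    cancelled.\<close>
  have "poly ((coeff V (?d - 1) + pderiv ?R) * (S * ?R)) a = 0" for a
  proof (cases "poly S a = 0 \<or> poly ?R a = 0")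
    case False
    with *[of a] show ?thesis by simp
  qed auto
  then have "(coeff V (?d - 1) + pderiv ?R) * (S * ?R) = 0" using poly_all_0_iff_0 by blast
  with R0 S0 have "coeff V (?d - 1) + pderiv ?R = 0" by (metis mult_eq_0_iff)
  then show ?thesis by (rule eq_neg_iff_add_eq_0[THEN iffD2])
qed

section \<open>Zeros on vertical lines\<close>

lemma not_coprime_common_root:
  fixes p q :: "complex poly"
  assumes "p \<noteq> 0" "\<not> coprime p q"
  shows "\<exists>b. poly p b = 0 \<and> poly q b = 0"
proof -
  obtain c where c: "c dvd p" "c dvd q" "\<not> is_unit c" using assms(2) by (auto simp: coprime_def)
  have "c \<noteq> 0" using assms(1) c(1) by auto
  with c(3) have "\<not> constant (poly c)" by (simp add: constant_degree is_unit_iff_degree)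
  then obtain b where "poly c b = 0" using fundamental_theorem_of_algebra by blast
  with c show ?thesis by (auto elim!: dvdE)
qed

text \<open>The norm commutes with evaluation at \<open>a\<close>. If it vanishes there, the
  restricted polynomials have a common factor, hence a common root. The other direction evaluates
  the Bezout identity.\<close>

lemma poly_norm_eq_0_iff:
  assumes F: "lead_coeff F = 1" "degree F > 0"
  shows "poly (poly_norm F G) a = 0 \<longleftrightarrow> (\<exists>b. eval_xy F a b = 0 \<and> eval_xy G a b = 0)"
proof
  assume "\<exists>b. eval_xy F a b = 0 \<and> eval_xy G a b = 0"
  then obtain b where b: "eval_xy F a b = 0" "eval_xy G a b = 0" by blast
  obtain U V where "[:poly_norm F G:] = U * F + V * G" using poly_norm_bezout[OF F, of G] by blast
  from arg_cong[OF this, of "\<lambda>p. eval_xy p a b"] b show "poly (poly_norm F G) a = 0" by simp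
next
  assume R: "poly (poly_norm F G) a = 0"
  have f: "lead_coeff (slice a F) = 1" "degree (slice a F) > 0" using slice_monic[OF F(1)] F(2) by simp_all
  have "poly_norm (slice a F) (slice a G) = 0"
    unfolding slice_def using poly_norm_hom[OF poly_hom.comm_ring_hom_axioms F, of a G] R by simp
  then have "\<not> coprime (slice a F) (slice a G)" using poly_norm_nonzero[OF f] by blast
  moreover have "slice a F \<noteq> 0" using f by auto
  ultimately obtain b where "poly (slice a F) b = 0" "poly (slice a G) b = 0"
    using not_coprime_common_root by blast
  then show "\<exists>b. eval_xy F a b = 0 \<and> eval_xy G a b = 0" by auto
qed

lemma slice_simps:
  "slice a (p - q) = slice a p - slice a q" "slice a (p + q) = slice a p + slice a q"
  "slice a (p * q) = slice a p * slice a q"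
proof -
  interpret h: comm_ring_hom "\<lambda>q. poly q a" by (rule poly_hom.comm_ring_hom_axioms)
  interpret m: map_poly_comm_ring_hom "\<lambda>q. poly q a" ..
  show "slice a (p - q) = slice a p - slice a q" "slice a (p + q) = slice a p + slice a q"
    "slice a (p * q) = slice a p * slice a q"
    unfolding slice_def by (simp_all add: m.hom_minus m.hom_add m.hom_mult)
qed

lemma slice_lift: "slice a (map_poly (\<lambda>c. [:c:]) p) = p"
  by (rule poly_eqI) (simp add: coeff_slice coeff_map_poly)

lemma slice_const: "slice a [:p:] = [:poly p a:]"
  by (rule poly_eqI) (simp add: coeff_slice coeff_pCons split: nat.splits)

lemma slice_eq_0:
  assumes "slice a p = 0"
  shows "[:[:- a, 1:]:] dvd p"
  unfolding const_poly_dvd_iff poly_eq_0_iff_dvd[symmetric]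
  using assms by (simp add: poly_eq_iff coeff_slice)

definition vertically_separated :: "bpoly \<Rightarrow> bpoly \<Rightarrow> bool" where
  "vertically_separated F G \<longleftrightarrow>
     (\<forall>a b b'. (a, b) \<in> curve F \<inter> curve G \<longrightarrow> (a, b') \<in> curve F \<inter> curve G \<longrightarrow> b = b')"

text \<open>Every root of the gcd is a common zero above \<open>a\<close>, so separation leaves at
  most one root. A double root would make both \<open>y\<close>-derivatives vanish there, and with
  them the Jacobian.\<close>

lemma fibre_gcd_linear:
  assumes F: "lead_coeff F = 1" and J: "jacobian (F, G) = 1"
    and uniq: "vertically_separated F G"
  shows "\<exists>y. gcd (slice a F) (slice a G) dvd [:- y, 1:]"
proof (cases "is_unit (gcd (slice a F) (slice a G))")
  case True
  then show ?thesis using unit_imp_dvd by blast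
next
  case False
  let ?h = "gcd (slice a F) (slice a G)"
  have "slice a F \<noteq> 0" using slice_monic[OF F, of a] by auto
  then have h0: "?h \<noteq> 0" by simp
  have zero: "eval_xy F a b = 0 \<and> eval_xy G a b = 0" if "poly ?h b = 0" for b
  proof -
    have "[:- b, 1:] dvd ?h" using that by (simp add: poly_eq_0_iff_dvd)
    then have "[:- b, 1:] dvd slice a F" "[:- b, 1:] dvd slice a G" by simp_all
    then show ?thesis by (simp flip: poly_eq_0_iff_dvd)
  qed
  obtain y where y: "poly ?h y = 0"
    using False h0 fundamental_theorem_of_algebra[of ?h] by (auto simp: constant_degree is_unit_iff_degree)
  then obtain k where k: "?h = [:- y, 1:] * k" unfolding poly_eq_0_iff_dvd by (rule dvdE)
  have "\<not> poly k b = 0" for b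
  proof
    assume b: "poly k b = 0"
    then have "poly ?h b = 0" by (simp add: k)
    with zero y uniq have "b = y" unfolding vertically_separated_def curve_def by blast
    with b obtain l where l: "k = [:- y, 1:] * l" unfolding poly_eq_0_iff_dvd by blast
    have "?h dvd slice a F" "?h dvd slice a G" by simp_all
    then obtain u v where "slice a F = [:- y, 1:] * ([:- y, 1:] * l) * u" "slice a G = [:- y, 1:] * ([:- y, 1:] * l) * v"
      unfolding k l by (metis dvdE)
    moreover have double_root: "poly (pderiv (p * (p * l) * w)) y = 0" if "poly p y = 0" for p w
      using that by (simp add: pderiv_mult)
    ultimately have "poly (pderiv (slice a F)) y = 0" "poly (pderiv (slice a G)) y = 0"
      using double_root[of "[:- y, 1:]"] by (simp_all del: mult_pCons_left mult_pCons_right)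
    with eval_jacobian[OF J, of a y] show False by (simp add: pderiv_slice)
  qed
  then have "constant (poly k)" using fundamental_theorem_of_algebra by blast
  moreover have "k \<noteq> 0" using h0 k by auto
  ultimately have "is_unit k" by (simp add: constant_degree is_unit_iff_degree)
  then have "?h dvd [:- y, 1:]" unfolding k by (simp only: mult_unit_dvd_iff dvd_refl)
  then show ?thesis ..
qed

text \<open>
  A Nakayama argument: modulo every \<open>x - a\<close> the quotient by \<open>(F, G)\<close> is generated by \<open>1\<close>, and one
  multiplies up over the roots of \<open>D\<close>.
\<close>

lemma quotient_generated_by_1:
  assumes F: "lead_coeff F = 1" and J: "jacobian (F, G) = 1"
    and uniq: "vertically_separated F G"
    and D: "D \<noteq> 0"
  shows "\<exists>s A B q. p = [:s:] + A * F + B * G + [:D:] * q"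
  using D
proof (induction "degree D" arbitrary: D)
  case 0
  then obtain c where c: "D = [:c:]" "c \<noteq> 0" by (metis degree_eq_zeroE pCons_0_0)
  have "[:D:] * ([:[:1 / c:]:] * p) = p" using c by (simp add: pCons_one)
  then have "p = [:0:] + 0 * F + 0 * G + [:D:] * ([:[:1 / c:]:] * p)" by simp
  then show ?case by blast
next
  case (Suc m)
  then have "\<not> constant (poly D)" by (simp add: constant_degree)
  then obtain a where "poly D a = 0" using fundamental_theorem_of_algebra by blast
  then obtain E where E: "D = [:- a, 1:] * E" by (auto simp: poly_eq_0_iff_dvd)
  have E0: "E \<noteq> 0" using Suc.prems E by auto
  have "degree D = 1 + degree E" unfolding E using E0 by (subst degree_mult_eq) auto
  with Suc.hyps(2) have "m = degree E" by simp
  from Suc.hyps(1)[OF this E0] obtain s A B q where q: "p = [:s:] + A * F + B * G + [:E:] * q" by blast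
  obtain y where y: "gcd (slice a F) (slice a G) dvd [:- y, 1:]"
    using fibre_gcd_linear[OF F J uniq] by blast
  \<comment> \<open>Modulo \<open>[:- y, 1:]\<close>, and hence modulo the gcd, the restriction of
    \<open>q\<close> equals its value at \<open>y\<close>.\<close>
  have "[:- y, 1:] dvd slice a q - [:eval_xy q a y:]" by (simp flip: poly_eq_0_iff_dvd)
  with y have "gcd (slice a F) (slice a G) dvd slice a q - [:eval_xy q a y:]" by (rule dvd_trans)
  then obtain k where k: "slice a q - [:eval_xy q a y:] = gcd (slice a F) (slice a G) * k" ..
  obtain u v where uv: "u * slice a F + v * slice a G = gcd (slice a F) (slice a G)"
    using bezout_coefficients_fst_snd by blast
  let ?l = "map_poly (\<lambda>c. [:c:])"
  \<comment> \<open>The Bezout coefficients on the fibre are lifted to polynomials free of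
    \<open>x\<close>. The error vanishes on the line over \<open>a\<close>, so a factor
    \<open>x - a\<close> splits off.\<close>
  have "slice a (q - ([:[:eval_xy q a y:]:] + ?l (u * k) * F + ?l (v * k) * G)) = 0"
    using k unfolding slice_simps slice_lift uv[symmetric] slice_const
    by (simp add: algebra_simps)
  then obtain r where "q - ([:[:eval_xy q a y:]:] + ?l (u * k) * F + ?l (v * k) * G) = [:[:- a, 1:]:] * r"
    using slice_eq_0 by (metis dvdE)
  then have r: "q = [:[:eval_xy q a y:]:] + ?l (u * k) * F + ?l (v * k) * G + [:[:- a, 1:]:] * r"
    by (simp add: algebra_simps)
  have D': "[:D:] = [:E:] * [:[:- a, 1:]:]" by (simp add: E mult.commute)
  have "p = [:s + E * [:eval_xy q a y:]:] + (A + [:E:] * ?l (u * k)) * F + (B + [:E:] * ?l (v * k)) * G + [:D:] * r"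
  proof -
    have s: "[:s + E * [:eval_xy q a y:]:] = [:s:] + [:E:] * [:[:eval_xy q a y:]:]" by simp
    have "p = [:s:] + A * F + B * G + [:E:] * ([:[:eval_xy q a y:]:] + ?l (u * k) * F + ?l (v * k) * G + [:[:- a, 1:]:] * r)"
      using q r by simp
    also have "\<dots> = [:s + E * [:eval_xy q a y:]:] + (A + [:E:] * ?l (u * k)) * F + (B + [:E:] * ?l (v * k)) * G + [:D:] * r"
      unfolding D' s by (simp only: algebra_simps)
    finally show ?thesis .
  qed
  then show ?case by blast
qed

text \<open>For \<open>D = poly_norm F G\<close>, which lies in the ideal of \<open>F\<close> and
  \<open>G\<close>, the remainder in \<open>quotient_generated_by_1\<close> is absorbed by the
  cofactors. Reducing the second cofactor modulo \<open>F\<close> and comparing degrees in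
  \<open>y\<close> then bounds both.\<close>

lemma shape_lemma:
  assumes F: "lead_coeff F = 1" "degree F > 0" and G: "degree G < degree F" and J: "jacobian (F, G) = 1"
    and uniq: "vertically_separated F G"
  obtains L A B where "Y = [:L:] + A * F + B * G" "degree A < degree F" "degree B < degree F"
proof -
  let ?R = "poly_norm F G"
  obtain U V where UV: "[:?R:] = U * F + V * G" using poly_norm_bezout[OF F, of G] by blast
  have "?R \<noteq> 0" using poly_norm_nonzero[OF F jacobian_coprime[OF F(1) J]] .
  from quotient_generated_by_1[OF F(1) J uniq this, where p = Y]
  obtain L A B q where "Y = [:L:] + A * F + B * G + [:?R:] * q" by blast
  then have *: "Y = [:L:] + (A + q * U) * F + (B + q * V) * G" unfolding UV by (simp add: algebra_simps)
  define A1 where "A1 = A + q * U"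
  define B1 where "B1 = B + q * V"
  obtain r where r: "B1 = F * r + pseudo_mod B1 F" using F(1) by (rule pseudo_mod_monic)
  define B2 where "B2 = pseudo_mod B1 F"
  define A2 where "A2 = A1 + r * G"
  have Y: "Y = [:L:] + A2 * F + B2 * G"
    using * unfolding A1_def[symmetric] B1_def[symmetric] A2_def B2_def
    by (subst (asm) r) (simp add: algebra_simps)
  have B2: "degree B2 < degree F" unfolding B2_def by (rule pseudo_mod_degree_lt[OF F(2)])
  have "degree A2 < degree F"
  proof (cases "A2 = 0")
    case False
    have eq: "A2 * F = Y - [:L:] - B2 * G" using Y by (simp add: algebra_simps)
    have "degree (A2 * F) \<le> max 1 (degree B2 + degree G)"
      unfolding eq
    proof (intro degree_diff_le)
      show "degree (B2 * G) \<le> max 1 (degree B2 + degree G)"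
        using degree_mult_le[of B2 G] by linarith
    qed (simp_all add: Y_def)
    moreover have "degree (A2 * F) = degree A2 + degree F" using False F by (intro degree_mult_eq) auto
    ultimately show ?thesis using B2 G by linarith
  qed (use F in simp)
  with Y B2 that show thesis by blast
qed

text \<open>\<open>U * F = [:R:] - V * G\<close> has degree at most \<open>2 * degree F - 2\<close>,
  which leaves no room in \<open>U\<close> for a term of degree \<open>degree F - 1\<close> or more.
  Subtracting a multiple of \<open>U\<close> will therefore not disturb a top coefficient.\<close>

lemma bezout_cofactor_coeff:
  fixes F G :: "'a::idom poly"
  assumes F: "lead_coeff F = 1" and G: "degree G < degree F"
    and UV: "[:R:] = U * F + V * G" "degree V < degree F" and i: "degree F \<le> Suc i"
  shows "coeff U i = 0"
proof (rule ccontr)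
  assume c: "coeff U i \<noteq> 0"
  then have U: "U \<noteq> 0" "degree U \<ge> i" by (auto intro: le_degree)
  have "U * F = [:R:] - V * G" using UV by (simp add: algebra_simps)
  then have "degree (U * F) \<le> degree V + degree G"
    using degree_mult_le[of V G] by (auto intro!: degree_diff_le)
  moreover have "degree (U * F) = degree U + degree F" using U F by (intro degree_mult_eq) auto
  ultimately show False using U(2) G UV(2) i by linarith
qed

section \<open>Total degree and shears\<close>

lemma total_degree_leI:
  "(\<And>i j. coeff_xy p i j \<noteq> 0 \<Longrightarrow> i + j \<le> n) \<Longrightarrow> total_degree p \<le> n"
  by (simp add: total_degree_le_iff)

lemma coeff_xy_eq_0: "total_degree p < i + j \<Longrightarrow> coeff_xy p i j = 0"
  using total_degree_le_iff[of p "total_degree p"] by (meson le_refl not_le)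

lemma total_degree_add_le: "total_degree p \<le> n \<Longrightarrow> total_degree q \<le> n \<Longrightarrow> total_degree (p + q) \<le> n"
  unfolding total_degree_le_iff coeff_xy_def by (metis add.left_neutral coeff_add)

lemma total_degree_0 [simp]: "total_degree 0 = 0"
  by (simp add: total_degree_def coeff_xy_def)

lemma total_degree_sum_le:
  "(\<And>i. i \<in> I \<Longrightarrow> total_degree (p i) \<le> n) \<Longrightarrow> total_degree (sum p I) \<le> n"
  by (induction I rule: infinite_finite_induct) (auto intro: total_degree_add_le)

lemma total_degree_mult_le: "total_degree (p * q) \<le> total_degree p + total_degree q"
proof (rule total_degree_leI)
  fix i j assume "coeff_xy (p * q) i j \<noteq> 0"
  then have "(\<Sum>l\<le>j. \<Sum>k\<le>i. coeff_xy p k l * coeff_xy q (i - k) (j - l)) \<noteq> 0"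
    by (simp add: coeff_xy_def coeff_mult coeff_sum)
  then obtain l where l: "l \<in> {..j}" "(\<Sum>k\<le>i. coeff_xy p k l * coeff_xy q (i - k) (j - l)) \<noteq> 0"
    by (rule sum.not_neutral_contains_not_neutral)
  from l(2) obtain k where k: "k \<in> {..i}" "coeff_xy p k l * coeff_xy q (i - k) (j - l) \<noteq> 0"
    by (rule sum.not_neutral_contains_not_neutral)
  from k(2) have "k + l \<le> total_degree p" "(i - k) + (j - l) \<le> total_degree q"
    using coeff_xy_eq_0 by (auto simp: not_less[symmetric])
  with k(1) l(1) show "i + j \<le> total_degree p + total_degree q" by simp
qed

lemma total_degree_power_le: "total_degree (p ^ i) \<le> i * total_degree p"
proof (induction i)
  case 0
  show ?case using coeff_xy_X_power[of 0] by (intro total_degree_leI) (auto split: if_splits)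
next
  case (Suc i)
  then show ?case using total_degree_mult_le[of p "p ^ i"] by simp
qed

lemma total_degree_const: "total_degree [:q:] \<le> degree q"
  by (intro total_degree_leI) (auto simp: coeff_xy_def coeff_pCons le_degree split: nat.splits)

lemma x_power_plus_lower_add:
  assumes "x_power_plus_lower n p" "total_degree q < n"
  shows "x_power_plus_lower n (p + q)"
proof -
  obtain r where r: "p = X ^ n + r" "total_degree r < n" using assms(1) by (auto simp: x_power_plus_lower_def)
  then have "total_degree (r + q) \<le> n - 1" using assms(2) by (intro total_degree_add_le) auto
  with r assms(2) show ?thesis unfolding x_power_plus_lower_def by (intro exI[of _ "r + q"]) auto
qed

lemma total_degree_X_power: "total_degree (X ^ n) \<le> n"
  by (rule total_degree_leI) (auto split: if_splits)

lemma x_power_plus_lower_mult: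
  assumes "x_power_plus_lower m p" "x_power_plus_lower n q"
  shows "x_power_plus_lower (m + n) (p * q)"
proof -
  obtain r s where r: "p = X ^ m + r" "total_degree r < m" and s: "q = X ^ n + s" "total_degree s < n"
    using assms by (auto simp: x_power_plus_lower_def)
  let ?t = "X ^ m * s + (r * X ^ n + r * s)"
  have "total_degree ?t \<le> m + n - 1"
  proof (intro total_degree_add_le)
    show "total_degree (X ^ m * s) \<le> m + n - 1" "total_degree (r * X ^ n) \<le> m + n - 1" "total_degree (r * s) \<le> m + n - 1"
      using total_degree_mult_le[of "X ^ m" s] total_degree_mult_le[of r "X ^ n"] total_degree_mult_le[of r s]
        total_degree_X_power[of m] total_degree_X_power[of n] r(2) s(2) by linarith+
  qed
  moreover have "p * q = X ^ (m + n) + ?t" by (simp add: r(1) s(1) algebra_simps power_add)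
  ultimately show ?thesis using r(2) unfolding x_power_plus_lower_def by (intro exI[of _ ?t]) auto
qed

lemma x_power_plus_lower_power:
  assumes "x_power_plus_lower m p" "d > 0"
  shows "x_power_plus_lower (m * d) (p ^ d)"
  using assms(2)
proof (induction d rule: nat_induct_non_zero)
  case (Suc d)
  then show ?case using x_power_plus_lower_mult[OF assms(1), of "m * d" "p ^ d"] by simp
qed (use assms in simp)

section \<open>Shears in the direction of \<open>y\<close>\<close>

definition shear :: "complex poly \<Rightarrow> bpoly \<Rightarrow> bpoly" where
  "shear L p = pcompose p [:L, 1:]"

lemma shear_simps [simp]:
  "shear L 0 = 0" "shear L 1 = 1" "shear L (p + q) = shear L p + shear L q"
  "shear L (p - q) = shear L p - shear L q" "shear L (p * q) = shear L p * shear L q"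
  "shear L (p ^ n) = shear L p ^ n" "shear L [:c:] = [:c:]" "shear L (pCons c p) = [:c:] + [:L, 1:] * shear L p"
  by (simp_all add: shear_def pcompose_add pcompose_diff pcompose_mult pcompose_hom.hom_power pcompose_pCons)

lemma shear_sum: "shear L p = (\<Sum>i\<le>degree p. [:coeff p i:] * [:L, 1:] ^ i)"
proof -
  have "degree (map_poly (\<lambda>x. [:x:]) p) = degree p" by (rule degree_map_poly) simp
  then show ?thesis by (simp add: shear_def pcompose_altdef poly_altdef coeff_map_poly)
qed

lemma jacobian_shear: "jacobian (shear L f, shear L g) = shear L (jacobian (f, g))"
proof -
  have y: "partial_y (shear L p) = shear L (partial_y p)" for p
    by (simp add: shear_def partial_y_def pderiv_pcompose pderiv_pCons)
  have x: "partial_x (shear L p) = shear L (partial_x p) + [:pderiv L:] * shear L (partial_y p)" for p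
  proof (induction p)
    case (pCons c p)
    have "partial_x [:L, 1:] = [:pderiv L:]" by (simp add: partial_x_pCons)
    with pCons show ?case
      by (simp add: partial_x_add partial_x_mult partial_x_pCons partial_y_def pderiv_pCons algebra_simps
          del: mult_pCons_left mult_pCons_right)
  qed simp
  show ?thesis unfolding jacobian_def fst_conv snd_conv x y shear_simps by (simp add: algebra_simps)
qed

text \<open>A weighted degree: \<open>y\<close> gets weight \<open>k\<close> because its image
  \<open>y + L\<close> has total degree at most \<open>k\<close>.\<close>

lemma total_degree_shear_le:
  assumes "degree L \<le> k" "k > 0"
    and "\<And>i. coeff p i \<noteq> 0 \<Longrightarrow> degree (coeff p i) + k * i \<le> n"
  shows "total_degree (shear L p) \<le> n"
  unfolding shear_sum
proof (rule total_degree_sum_le)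
  fix i
  have L: "total_degree [:L, 1:] \<le> k"
  proof (rule total_degree_leI)
    fix i j assume "coeff_xy [:L, 1:] i j \<noteq> 0"
    then show "i + j \<le> k" using assms(1,2) le_degree[of L i]
      by (cases "j = 0"; cases "j = 1"; cases "i = 0") (auto simp: coeff_xy_def coeff_pCons split: nat.splits)
  qed
  show "total_degree ([:coeff p i:] * [:L, 1:] ^ i) \<le> n"
  proof (cases "coeff p i = 0")
    case False
    have "total_degree ([:coeff p i:] * [:L, 1:] ^ i) \<le> degree (coeff p i) + i * k"
      using total_degree_mult_le[of "[:coeff p i:]" "[:L, 1:] ^ i"] total_degree_const[of "coeff p i"]
        total_degree_power_le[of "[:L, 1:]" i] mult_le_mono2[OF L, of i] by linarith
    with assms(3)[OF False] show ?thesis by (simp add: mult.commute)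
  qed simp
qed

lemma coeff_mult_top:
  assumes "degree p \<le> a" "degree q \<le> b"
  shows "coeff (p * q) (a + b) = coeff p a * coeff q b"
proof -
  have "coeff p i * coeff q (a + b - i) = (if i = a then coeff p a * coeff q b else 0)" if "i \<le> a + b" for i
    using that assms by (cases i a rule: linorder_cases) (auto simp: coeff_eq_0)
  then have "coeff (p * q) (a + b) = (\<Sum>i\<le>a + b. if i = a then coeff p a * coeff q b else 0)"
    unfolding coeff_mult by (intro sum.cong) auto
  then show ?thesis by simp
qed

lemma poly_as_sum_coeff:
  fixes p :: "'a::comm_semiring_1 poly"
  assumes "degree p < d"
  shows "poly p x = (\<Sum>i<d. coeff p i * x ^ i)"
  by (subst poly_as_sum_less[OF assms]) (simp add: poly_sum poly_monom)

lemma coeff_shear_0: "coeff (shear L p) 0 = poly p L"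
  by (simp add: shear_def pcompose_coeff_0)

section \<open>The coefficient of the cofactor\<close>

text \<open>The right-hand side of the equivalence, named to serve as a hypothesis. Since it speaks
  of every pair of cofactors within the degree bound, it can be applied to explicitly constructed
  ones.\<close>

definition noether_coefficient_one :: bool where
  "noether_coefficient_one \<longleftrightarrow>
     (\<forall>f1 f2 g1 g2 :: bpoly. \<forall>n :: nat.
        jacobian (f1, f2) = 1 \<longrightarrow>
        n > 0 \<longrightarrow> x_power_plus_lower n f1 \<longrightarrow> x_power_plus_lower n f2 \<longrightarrow>
        curve f1 \<inter> curve f2 \<subseteq> {(a, b). b = 0} \<longrightarrow>
        total_degree g1 \<le> n - 1 \<longrightarrow> total_degree g2 \<le> n - 1 \<longrightarrow>
        Y = g1 * f1 + g2 * f2 \<longrightarrow>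
        coeff_xy g2 (n - 1) 0 = 1)"

lemma degree_coeff_le_sum: "degree (coeff p i) \<le> (\<Sum>j\<le>degree p. degree (coeff p j))"
proof (cases "i \<le> degree p")
  case True
  then show ?thesis by (intro member_le_sum) auto
qed (simp add: coeff_eq_0)

text \<open>Giving up a power of \<open>y\<close> costs \<open>k\<close> in weighted degree and
  gains at most \<open>K\<close> from the coefficients, so the leading form is that of
  \<open>(y + L)^d\<close> with \<open>d = degree F\<close>, a power of \<open>x\<close>.\<close>

lemma x_power_plus_lower_shear:
  assumes F: "lead_coeff F = 1" "degree F > 0" and K: "\<And>i. degree (coeff F i) \<le> K"
    and L: "degree L = k" "lead_coeff L = 1" and k: "k > Suc K"
  shows "x_power_plus_lower (k * degree F) (shear L F)"
proof -
  let ?d = "degree F"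
  define T where "T = F - monom 1 ?d"
  have T: "coeff T i = (if i < ?d then coeff F i else 0)" for i
    using F(1) by (auto simp: T_def coeff_eq_0)
  have pos: "k * ?d > 0" using F(2) k by auto
  have "total_degree (shear L T) \<le> k * ?d - 1"
  proof (rule total_degree_shear_le)
    fix i assume "coeff T i \<noteq> 0"
    then have i: "i < ?d" by (auto simp: T split: if_splits)
    then have "k * Suc i \<le> k * ?d" by (intro mult_le_mono2) auto
    then show "degree (coeff T i) + k * i \<le> k * ?d - 1" using K[of i] k i by (simp add: T)
  qed (use L k in auto)
  then have "total_degree (shear L T) < k * ?d" using pos by linarith
  moreover have "x_power_plus_lower (k * ?d) ([:L, 1:] ^ ?d)"
  proof (rule x_power_plus_lower_power)
    have "total_degree [:L - monom 1 k, 1:] \<le> k - 1"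
    proof (rule total_degree_leI)
      fix i j assume ij: "coeff_xy [:L - monom 1 k, 1:] i j \<noteq> 0"
      show "i + j \<le> k - 1"
      proof (cases j)
        case 0
        with ij have c: "coeff (L - monom 1 k) i \<noteq> 0" by (simp add: coeff_xy_def)
        have "i < k"
        proof (rule ccontr)
          assume "\<not> i < k"
          then have "coeff (L - monom 1 k) i = 0" using L by (cases "i = k") (auto simp: coeff_eq_0)
          with c show False ..
        qed
        with 0 show ?thesis by simp
      next
        case (Suc j')
        with ij have "j = 1" "i = 0" by (auto simp: coeff_xy_def coeff_pCons split: nat.splits)
        with k show ?thesis by simp
      qed
    qed
    moreover have "[:L, 1:] = X ^ k + [:L - monom 1 k, 1:]"
    proof -
      have "X ^ k = [:monom 1 k:]" by (simp add: X_def monom_altdef poly_const_pow)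
      then show ?thesis by simp
    qed
    ultimately show "x_power_plus_lower k [:L, 1:]"
      unfolding x_power_plus_lower_def using k by (intro exI[of _ "[:L - monom 1 k, 1:]"]) auto
  qed (use F in simp)
  ultimately have "x_power_plus_lower (k * ?d) ([:L, 1:] ^ ?d + shear L T)"
    by (intro x_power_plus_lower_add)
  moreover have "shear L F = [:L, 1:] ^ ?d + shear L T"
  proof -
    have "F = [:0, 1:] ^ ?d + T" by (simp add: T_def monom_altdef)
    then have "shear L F = shear L ([:0, 1:] ^ ?d + T)" by simp
    then show ?thesis by (simp del: shear_simps(2))
  qed
  ultimately show ?thesis by simp
qed

text \<open>Setting \<open>y = L\<close> restricts the sheared polynomial to the axis. Since
  \<open>k * d - 1 = k * (d - 1) + (k - 1)\<close> and \<open>L\<close> is monic of degree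
  \<open>k\<close>, only the term with \<open>L ^ (d - 1)\<close> reaches that degree.\<close>

lemma poly_top_coeff_bound:
  fixes p :: bpoly
  assumes d: "degree p < d" and L: "degree L = k" "lead_coeff L = 1"
    and top: "degree (coeff p (d - 1)) < k"
    and low: "\<And>i. Suc i < d \<Longrightarrow> degree (coeff p i) + Suc (k * i) < k * (d - 1) + k"
  shows "coeff (poly p L) (k * d - 1) = coeff (coeff p (d - 1)) (k - 1)"
proof -
  have n: "k * d - 1 = (k - 1) + k * (d - 1)" "k * d = k * (d - 1) + k" using d top by (cases d; simp)+
  have pow: "degree (L ^ i) = k * i" "lead_coeff (L ^ i) = 1" for i
  proof -
    have "L \<noteq> 0" using L(2) by auto
    then show "degree (L ^ i) = k * i" using L(1) by (simp add: degree_power_eq)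
    show "lead_coeff (L ^ i) = 1" using L(2) by (simp add: lead_coeff_power)
  qed
  have "poly p L = (\<Sum>i<d. coeff p i * L ^ i)" using d by (rule poly_as_sum_coeff)
  then have "coeff (poly p L) (k * d - 1) = (\<Sum>i<d. coeff (coeff p i * L ^ i) (k * d - 1))"
    by (simp add: coeff_sum)
  also have "\<dots> = (\<Sum>i<d. if i = d - 1 then coeff (coeff p (d - 1)) (k - 1) else 0)"
  proof (intro sum.cong refl)
    fix i assume "i \<in> {..<d}"
    then consider "i = d - 1" | "Suc i < d" by fastforce
    then show "coeff (coeff p i * L ^ i) (k * d - 1) = (if i = d - 1 then coeff (coeff p (d - 1)) (k - 1) else 0)"
    proof cases
      case 1
      have "coeff (coeff p i * L ^ i) ((k - 1) + k * i) = coeff (coeff p i) (k - 1) * coeff (L ^ i) (k * i)"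
        using top 1 pow by (intro coeff_mult_top) auto
      then show ?thesis using 1 pow[of i] n by simp
    next
      case 2
      have "degree (coeff p i * L ^ i) \<le> degree (coeff p i) + k * i"
        using degree_mult_le[of "coeff p i" "L ^ i"] pow[of i] by simp
      then have "degree (coeff p i * L ^ i) < k * d - 1" using low[OF 2] n by linarith
      then show ?thesis using 2 by (simp add: coeff_eq_0)
    qed
  qed
  finally show ?thesis using d by simp
qed

text \<open>The coefficient hypothesis is evaluated on a sheared copy of \<open>(F, F + G)\<close>;
  the coefficient that it forces to be 1 turns out to be the degree of the norm.\<close>

lemma degree_poly_norm_eq_1:
  assumes S: noether_coefficient_one
    and F: "lead_coeff F = 1" "degree F > 0" and G: "degree G < degree F" and J: "jacobian (F, G) = 1"
    and sep: "vertically_separated F G"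
  shows "degree (poly_norm F G) = 1"
proof -
  let ?d = "degree F" and ?R = "poly_norm F G"
  let ?D = "\<lambda>p :: bpoly. \<Sum>j\<le>degree p. degree (coeff p j)"
  obtain U V where UV: "[:?R:] = U * F + V * G" "degree V < ?d" using poly_norm_bezout[OF F, of G] by blast
  have V: "coeff V (?d - 1) = - pderiv ?R" using bezout_top_coeff[OF F J UV] .
  note V' = V[simplified]
  have U: "coeff U i = 0" if "?d \<le> Suc i" for i using bezout_cofactor_coeff[OF F(1) G UV that] .
  have R0: "?R \<noteq> 0" using poly_norm_nonzero[OF F jacobian_coprime[OF F(1) J]] .
  obtain L0 A B where Y: "Y = [:L0:] + A * F + B * G" and deg: "degree A < ?d" "degree B < ?d"
    using shape_lemma[OF F G J sep] by blast
  define K where "K = ?D F + ?D G + ?D U + ?D V + ?D A + ?D B + degree L0"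
  have K: "degree (coeff F i) \<le> K" "degree (coeff G i) \<le> K" "degree (coeff U i) \<le> K"
    "degree (coeff V i) \<le> K" "degree (coeff A i) \<le> K" "degree (coeff B i) \<le> K" "degree L0 \<le> K" for i
    using degree_coeff_le_sum[of F i] degree_coeff_le_sum[of G i] degree_coeff_le_sum[of U i]
      degree_coeff_le_sum[of V i] degree_coeff_le_sum[of A i] degree_coeff_le_sum[of B i]
    unfolding K_def by linarith+
  define m where "m = degree ?R"
  \<comment> \<open>Large enough that \<open>Q * ?R\<close> dominates \<open>L0\<close> and that the
    weight \<open>k\<close> exceeds all coefficient degrees, with slack 2 for the strict bounds. The
    factor \<open>Q\<close> makes \<open>Q * ?R\<close> monic of degree \<open>k\<close>.\<close>
  define k where "k = K + m + 2"
  define Q where "Q = monom (1 / lead_coeff ?R) (k - m)"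
  define L where "L = L0 + Q * ?R"
  have degQ: "degree Q = k - m" using R0 by (simp add: Q_def degree_monom_eq)
  have "lead_coeff (Q * ?R) = 1" "degree (Q * ?R) = k"
  proof -
    have "Q \<noteq> 0" using R0 by (simp add: Q_def)
    then show "degree (Q * ?R) = k" using R0 degQ by (simp add: degree_mult_eq k_def m_def)
    have "lead_coeff Q = 1 / lead_coeff ?R" unfolding degQ by (simp add: Q_def)
    then show "lead_coeff (Q * ?R) = 1" using R0 by (simp add: lead_coeff_mult)
  qed
  moreover have "degree L0 < k" using K(7) by (simp add: k_def)
  ultimately have L: "degree L = k" "lead_coeff L = 1"
    unfolding L_def by (simp_all add: degree_add_eq_right coeff_eq_0)
  define n where "n = k * ?d"
  have n0: "n > 0" using F(2) by (simp add: n_def k_def)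
  have step: "k * i + k \<le> n" if "i < ?d" for i
  proof -
    have "k * Suc i \<le> k * ?d" using that by (intro mult_le_mono2) auto
    then show ?thesis by (simp add: n_def)
  qed
  have step2: "k * i + k + k \<le> n" if "Suc i < ?d" for i using step[OF that] by simp
  \<comment> \<open>Subtracting \<open>Q\<close> times the Bezout identity of the norm turns the
    cofactors for \<open>Y - [:L0:]\<close> into cofactors for \<open>Y - [:L:]\<close>.\<close>
  define P where "P = B - [:Q:] * V"
  define T where "T = A - [:Q:] * U"
  define f where "f = shear L F"
  define h where "h = shear L G"
  have Pc: "coeff P i = coeff B i - Q * coeff V i" for i by (simp add: P_def)
  have Tc: "coeff T i = coeff A i - Q * coeff U i" for i by (simp add: T_def)
  have degP: "degree P < ?d"
    using deg(2) UV(2) unfolding P_def by (intro degree_diff_less) (auto intro: le_less_trans[OF degree_smult_le])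
  have Plow: "degree (coeff P i) \<le> k - m + K" if "Suc i < ?d" for i
    unfolding Pc using K(4,6)[of i] degree_mult_le[of Q "coeff V i"] degQ by (intro degree_diff_le) linarith+
  \<comment> \<open>The decisive bound: \<open>Q\<close> contributes degree \<open>k - m\<close>,
    but the top coefficient of \<open>V\<close> is \<open>- pderiv ?R\<close>, of degree at most
    \<open>m - 1\<close> when \<open>m > 0\<close>, which just keeps the product below degree
    \<open>k\<close>.\<close>
  have Ptop: "degree (coeff P (?d - 1)) < k"
  proof -
    have "degree (Q * coeff V (?d - 1)) \<le> k - 1"
    proof (cases "m = 0")
      case True
      then have "pderiv ?R = 0" by (simp add: m_def pderiv_eq_0_iff)
      then show ?thesis by (simp add: V')
    next
      case False
      have "degree (Q * coeff V (?d - 1)) \<le> (k - m) + (m - 1)"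
        using degree_mult_le[of Q "coeff V (?d - 1)"] degQ by (simp add: V' degree_pderiv m_def)
      then show ?thesis using False by (simp add: k_def)
    qed
    moreover have "degree (coeff B (?d - 1)) \<le> k - 1" using K(6)[of "?d - 1"] by (simp add: k_def)
    ultimately have "degree (coeff P (?d - 1)) \<le> k - 1" unfolding Pc by (intro degree_diff_le)
    then show ?thesis by (simp add: k_def)
  qed
  have tdP: "total_degree (shear L P) \<le> n - 1"
  proof (rule total_degree_shear_le)
    fix i assume "coeff P i \<noteq> 0"
    then have i: "i < ?d" using degP le_degree[of P i] by linarith
    then consider "i = ?d - 1" | "Suc i < ?d" by fastforce
    then show "degree (coeff P i) + k * i \<le> n - 1"
    proof cases
      case 1
      with Ptop step[OF i] show ?thesis by simp
    next
      case 2
      with Plow[OF 2] step2[OF 2] show ?thesis by (simp add: k_def)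
    qed
  qed (use L in \<open>auto simp: k_def\<close>)
  have tdT: "total_degree (shear L T) \<le> n - 1"
  proof (rule total_degree_shear_le)
    fix i assume c: "coeff T i \<noteq> 0"
    have i: "i < ?d"
    proof (rule ccontr)
      assume "\<not> i < ?d"
      then have "coeff T i = 0" using deg(1) U[of i] by (simp add: Tc coeff_eq_0)
      with c show False ..
    qed
    show "degree (coeff T i) + k * i \<le> n - 1"
    proof (cases "Suc i < ?d")
      case True
      have "degree (coeff T i) \<le> k - m + K"
        unfolding Tc using K(3,5)[of i] degree_mult_le[of Q "coeff U i"] degQ by (intro degree_diff_le) linarith+
      with step2[OF True] show ?thesis by (simp add: k_def)
    next
      case False
      then have "coeff T i = coeff A i" using U[of i] by (simp add: Tc)
      with K(5)[of i] step[OF i] show ?thesis by (simp add: k_def)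
    qed
  qed (use L in \<open>auto simp: k_def\<close>)
  have tdh: "total_degree h \<le> n - 1"
    unfolding h_def
  proof (rule total_degree_shear_le)
    fix i assume "coeff G i \<noteq> 0"
    then have "i < ?d" using G le_degree[of G i] by linarith
    from step[OF this] K(2)[of i] show "degree (coeff G i) + k * i \<le> n - 1" by (simp add: k_def)
  qed (use L in \<open>auto simp: k_def\<close>)
  have xf: "x_power_plus_lower n f"
    unfolding n_def f_def using K(1) L by (intro x_power_plus_lower_shear[OF F, of K]) (auto simp: k_def)
  \<comment> \<open>\<open>h\<close> has total degree below \<open>n\<close>; adding
    \<open>f\<close> gives the second component the required leading form and changes neither the
    common zeros nor the Jacobian.\<close>
  have xfh: "x_power_plus_lower n (f + h)"
    using xf tdh n0 by (intro x_power_plus_lower_add) auto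
  have "[:L:] = [:L0:] + [:Q:] * [:?R:]" by (simp add: L_def)
  then have "Y - [:L:] = T * F + P * G"
    unfolding UV(1) by (subst Y) (simp add: T_def P_def algebra_simps del: mult_pCons_left mult_pCons_right)
  then have "shear L (Y - [:L:]) = shear L T * f + shear L P * h" by (simp add: f_def h_def)
  moreover have "shear L (Y - [:L:]) = Y" by (simp add: Y_def)
  ultimately have YY: "Y = shear L T * f + shear L P * h" by simp
  then have eq: "Y = (shear L T - shear L P) * f + shear L P * (f + h)" by (simp add: algebra_simps)
  have curve: "curve f \<inter> curve (f + h) \<subseteq> {(a, b). b = 0}"
  proof -
    have "b = 0" if "eval_xy f a b = 0" "eval_xy (f + h) a b = 0" for a b
      using arg_cong[OF eq, of "\<lambda>p. eval_xy p a b"] that by (simp del: eval_xy_add add: eval_xy_add[of "_ * f"])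
    then show ?thesis by (auto simp: curve_def)
  qed
  have "jacobian (f, f + h) = jacobian (f, h)"
    by (simp add: jacobian_def partial_x_add partial_y_add algebra_simps)
  also have "\<dots> = 1" by (simp add: f_def h_def jacobian_shear J)
  finally have J': "jacobian (f, f + h) = 1" .
  have tdg: "total_degree (shear L T - shear L P) \<le> n - 1"
  proof -
    have "total_degree (- shear L P) = total_degree (shear L P)" by (simp add: total_degree_def coeff_xy_def)
    then show ?thesis using total_degree_add_le[OF tdT, of "- shear L P"] tdP by simp
  qed
  have "coeff_xy (shear L P) (n - 1) 0 = 1"
    using S J' n0 xf xfh curve tdg tdP eq unfolding noether_coefficient_one_def by blast
  moreover have "coeff_xy (shear L P) (n - 1) 0 = coeff (poly P L) (k * ?d - 1)"
    by (simp add: coeff_xy_def coeff_shear_0 n_def)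
  moreover have "\<dots> = coeff (coeff P (?d - 1)) (k - 1)"
  proof (rule poly_top_coeff_bound[OF degP L Ptop])
    fix i assume i: "Suc i < ?d"
    have "n = k * (?d - 1) + k" using F(2) by (cases ?d) (auto simp: n_def)
    with Plow[OF i] step2[OF i] show "degree (coeff P i) + Suc (k * i) < k * (?d - 1) + k" by (simp add: k_def)
  qed
  \<comment> \<open>The top coefficient of \<open>B\<close> has degree at most
    \<open>K < k - 1\<close>, so only \<open>- Q * coeff V (?d - 1)\<close> contributes.\<close>
  moreover have "\<dots> = coeff (Q * pderiv ?R) (k - 1)"
    using K(6)[of "?d - 1"] by (simp add: Pc V' coeff_eq_0 k_def)
  \<comment> \<open>The leading coefficient of \<open>pderiv ?R\<close> is \<open>m\<close> times
    that of \<open>?R\<close>, which \<open>Q\<close> normalises away; a constant norm gives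
    0.\<close>
  moreover have "\<dots> = of_nat m"
  proof (cases "m = 0")
    case True
    then have "pderiv ?R = 0" by (simp add: m_def pderiv_eq_0_iff)
    with True show ?thesis by simp
  next
    case False
    then have "k - 1 = (m - 1) + (k - m)" by (simp add: k_def)
    then have "coeff (Q * pderiv ?R) (k - 1) = 1 / lead_coeff ?R * coeff (pderiv ?R) (m - 1)"
      by (simp add: Q_def coeff_monom_mult k_def)
    also have "\<dots> = of_nat m" using False R0 by (simp add: coeff_pderiv m_def)
    finally show ?thesis .
  qed
  ultimately have "of_nat m = (1 :: complex)" by simp
  then show ?thesis by (simp add: m_def)
qed

section \<open>Tilting to general position\<close>

lemma bpoly_eqI:
  assumes "\<And>a b. eval_xy p a b = eval_xy q a b"
  shows "p = q"
proof -
  have "slice a p = slice a q" for a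
    using assms poly_eq_poly_eq_iff[of "slice a p" "slice a q"] by (simp add: fun_eq_iff)
  then have "poly (coeff p k) a = poly (coeff q k) a" for a k
    by (metis coeff_slice)
  then have "coeff p k = coeff q k" for k
    using poly_eq_poly_eq_iff[of "coeff p k" "coeff q k"] by (simp add: fun_eq_iff)
  then show ?thesis by (rule poly_eqI)
qed

abbreviation const_xy :: "complex \<Rightarrow> bpoly" where
  "const_xy c \<equiv> [:[:c:]:]"

lemma eval_xy_const: "eval_xy (const_xy c) a b = c"
  by simp

text \<open>\<open>X\<close> and \<open>Y\<close> generate the ring over the constants. This serves
  for identities between substitutions and derivatives.\<close>

lemma bpoly_induct [case_names const X Y add mult]:
  assumes "\<And>c. P (const_xy c)" "P X" "P Y"
    and add: "\<And>p q. P p \<Longrightarrow> P q \<Longrightarrow> P (p + q)" and mult: "\<And>p q. P p \<Longrightarrow> P q \<Longrightarrow> P (p * q)"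
  shows "P p"
proof -
  have x: "P [:c:]" for c
  proof (induction c)
    case 0
    then show ?case using assms(1)[of 0] by simp
  next
    case (pCons a q)
    have "[:pCons a q:] = const_xy a + X * [:q:]" by (simp add: X_def)
    then show ?case using add mult assms(1,2) pCons by metis
  qed
  show ?thesis
  proof (induction p)
    case 0
    then show ?case using assms(1)[of 0] by simp
  next
    case (pCons c p)
    have "pCons c p = [:c:] + Y * p" by (simp add: Y_def)
    then show ?case using add mult assms(3) x pCons by metis
  qed
qed

lemma eval_xy_subst: "\<exists>q. \<forall>u v. eval_xy q u v = eval_xy p (eval_xy k u v) (eval_xy l u v)"
proof (induction p rule: bpoly_induct)
  case (const c)
  show ?case by (intro exI[of _ "const_xy c"]) simp
next
  case X
  show ?case by (intro exI[of _ k]) simp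
next
  case Y
  show ?case by (intro exI[of _ l]) simp
next
  case (add p q)
  then obtain p' q' where "\<forall>u v. eval_xy p' u v = eval_xy p (eval_xy k u v) (eval_xy l u v)"
    "\<forall>u v. eval_xy q' u v = eval_xy q (eval_xy k u v) (eval_xy l u v)" by blast
  then show ?case by (intro exI[of _ "p' + q'"]) simp
next
  case (mult p q)
  then obtain p' q' where "\<forall>u v. eval_xy p' u v = eval_xy p (eval_xy k u v) (eval_xy l u v)"
    "\<forall>u v. eval_xy q' u v = eval_xy q (eval_xy k u v) (eval_xy l u v)" by blast
  then show ?case by (intro exI[of _ "p' * q'"]) simp
qed

text \<open>On each horizontal line, and then on the line \<open>x = 0\<close>, the restriction is a
  polynomial in one variable without zeros, hence constant.\<close>

lemma nonvanishing_imp_constant: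
  assumes "\<And>a b. eval_xy p a b \<noteq> 0"
  shows "eval_xy p a b = eval_xy p 0 0"
proof -
  have x: "eval_xy p a b = eval_xy p 0 b" for a b
  proof -
    have "constant (poly (poly p [:b:]))"
      using fundamental_theorem_of_algebra[of "poly p [:b:]"] assms[of _ b] by (auto simp: eval_xy_def)
    then show ?thesis by (auto simp: eval_xy_def constant_def)
  qed
  have "constant (poly (slice 0 p))"
    using fundamental_theorem_of_algebra[of "slice 0 p"] assms[of 0] by auto
  then have "eval_xy p 0 b = eval_xy p 0 0" by (auto simp: constant_def)
  with x[of a b] show ?thesis by (rule trans)
qed

text \<open>The substitution \<open>x \<mapsto> x - t y\<close>, written out by monomials so that
  total degrees can be estimated term by term.\<close>

definition tilt :: "complex \<Rightarrow> bpoly \<Rightarrow> bpoly" where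
  "tilt t p = (\<Sum>j\<le>degree p. \<Sum>i\<le>degree (coeff p j).
      const_xy (coeff_xy p i j) * (X - const_xy t * Y) ^ i * Y ^ j)"

lemma eval_xy_sum: "eval_xy (sum f I) a b = (\<Sum>i\<in>I. eval_xy (f i) a b)"
  by (induction I rule: infinite_finite_induct) simp_all

lemma eval_xy_tilt [simp]: "eval_xy (tilt t p) a b = eval_xy p (a - t * b) b"
proof -
  have e: "eval_xy p x b = (\<Sum>j\<le>degree p. poly (coeff p j) x * b ^ j)" for x
    unfolding eval_xy_def by (subst poly_altdef) (simp add: poly_sum)
  have "eval_xy (tilt t p) a b = (\<Sum>j\<le>degree p. (\<Sum>i\<le>degree (coeff p j). coeff (coeff p j) i * (a - t * b) ^ i) * b ^ j)"
    by (simp add: tilt_def eval_xy_sum coeff_xy_def sum_distrib_right del: mult_pCons_left mult_pCons_right)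
  also have "\<dots> = (\<Sum>j\<le>degree p. poly (coeff p j) (a - t * b) * b ^ j)"
    by (simp only: poly_altdef)
  finally show ?thesis by (simp only: e)
qed

lemma tilt_simps [simp]:
  "tilt t (p + q) = tilt t p + tilt t q" "tilt t (p - q) = tilt t p - tilt t q"
  "tilt t (p * q) = tilt t p * tilt t q" "tilt t 1 = 1" "tilt t (const_xy c) = const_xy c"
  "tilt t X = X - const_xy t * Y" "tilt t Y = Y"
  by (rule bpoly_eqI, simp del: mult_pCons_left mult_pCons_right)+

lemma partial_const [simp]: "partial_x (const_xy c) = 0" "partial_y (const_xy c) = 0"
  by (simp_all add: partial_x_pCons partial_y_def)

lemma partial_X_Y [simp]: "partial_x X = 1" "partial_y X = 0" "partial_x Y = 0" "partial_y Y = 1"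
  by (simp_all add: X_def Y_def partial_x_pCons partial_y_def pderiv_pCons one_pCons)

lemma partial_x_tilt: "partial_x (tilt t p) = tilt t (partial_x p)"
proof (induction p rule: bpoly_induct)
  case (const c)
  have "tilt t 0 = 0" by (rule bpoly_eqI) simp
  then show ?case by simp
next
  case Y
  have "tilt t 0 = 0" by (rule bpoly_eqI) simp
  then show ?case by simp
qed (simp_all add: partial_x_add partial_x_mult partial_x_diff del: mult_pCons_left mult_pCons_right)

lemma partial_y_tilt: "partial_y (tilt t p) = tilt t (partial_y p) - const_xy t * tilt t (partial_x p)"
proof (induction p rule: bpoly_induct)
  case (const c)
  have "tilt t 0 = 0" by (rule bpoly_eqI) simp
  then show ?case by simp
next
  case X
  have "tilt t 0 = 0" by (rule bpoly_eqI) simp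
  then show ?case by (simp add: partial_y_diff partial_y_mult del: mult_pCons_left mult_pCons_right)
next
  case Y
  have "tilt t 0 = 0" by (rule bpoly_eqI) simp
  then show ?case by simp
next
  case (add p q)
  show ?case unfolding tilt_simps partial_x_add partial_y_add add by (simp only: algebra_simps)
next
  case (mult p q)
  show ?case unfolding tilt_simps partial_x_mult partial_y_mult partial_x_tilt mult by (simp only: algebra_simps)
qed

lemma jacobian_tilt: "jacobian (tilt t f, tilt t g) = tilt t (jacobian (f, g))"
  unfolding jacobian_def fst_conv snd_conv partial_x_tilt partial_y_tilt tilt_simps by (simp only: algebra_simps)

lemma total_degree_tilt_le: "total_degree (tilt t p) \<le> total_degree p"
  unfolding tilt_def
proof (intro total_degree_sum_le)
  fix i j
  let ?c = "const_xy (coeff_xy p i j)"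
  show "total_degree (?c * (X - const_xy t * Y) ^ i * Y ^ j) \<le> total_degree p"
  proof (cases "coeff_xy p i j = 0")
    case False
    then have ij: "i + j \<le> total_degree p" using coeff_xy_eq_0[of p i j] by linarith
    have "X - const_xy t * Y = [:[:0, 1:], [:- t:]:]" by (simp add: X_def Y_def)
    then have 1: "total_degree (X - const_xy t * Y) \<le> 1" "total_degree Y \<le> 1"
      by (auto simp: coeff_xy_def Y_def coeff_pCons intro!: total_degree_leI split: nat.splits if_splits)
    have "total_degree ?c = 0" using total_degree_const[of "[:coeff_xy p i j:]"] by simp
    moreover have "total_degree ((X - const_xy t * Y) ^ i) \<le> i" "total_degree (Y ^ j) \<le> j"
      using total_degree_power_le[of "X - const_xy t * Y" i] total_degree_power_le[of Y j] 1
        mult_le_mono2[OF 1(1), of i] mult_le_mono2[OF 1(2), of j] by linarith+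
    ultimately show ?thesis
      using ij total_degree_mult_le[of "?c * (X - const_xy t * Y) ^ i" "Y ^ j"]
        total_degree_mult_le[of ?c "(X - const_xy t * Y) ^ i"] by linarith
  qed simp
qed

lemma total_degree_attained:
  assumes "total_degree p > 0"
  shows "\<exists>i j. i + j = total_degree p \<and> coeff_xy p i j \<noteq> 0"
proof -
  have "total_degree p \<in> insert 0 {i + j | i j. coeff_xy p i j \<noteq> 0}"
    unfolding total_degree_def by (rule Max_in[OF finite.insertI[OF finite_support_degrees]]) simp
  with assms show ?thesis by force
qed

text \<open>With \<open>D\<close> the total degree, the coefficient of \<open>y^D\<close> is the
  leading form of \<open>p\<close> at \<open>(- t, 1)\<close>. This is a nonzero polynomial
  \<open>h\<close> in \<open>t\<close>, whose roots are the exceptions.\<close>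

lemma lead_coeff_tilt:
  assumes D: "total_degree p > 0"
  shows "\<exists>B. finite B \<and> (\<forall>t. t \<notin> B \<longrightarrow> (\<exists>c. c \<noteq> 0 \<and> lead_coeff (tilt t p) = [:c:] \<and> degree (tilt t p) = total_degree p))"
proof -
  let ?D = "total_degree p"
  define h where "h = (\<Sum>i\<le>?D. monom (coeff_xy p i (?D - i) * (- 1) ^ i) i)"
  obtain i j where ij: "i + j = ?D" "coeff_xy p i j \<noteq> 0" using total_degree_attained[OF D] by blast
  have "coeff h i = coeff_xy p i (?D - i) * (- 1) ^ i"
    using ij(1) by (simp add: h_def coeff_sum)
  moreover have "?D - i = j" using ij(1) by simp
  ultimately have "h \<noteq> 0" using ij(2) by auto
  then have fin: "finite {t. poly h t = 0}" by (rule poly_roots_finite)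
  have "\<exists>c. c \<noteq> 0 \<and> lead_coeff (tilt t p) = [:c:] \<and> degree (tilt t p) = ?D" if t: "poly h t \<noteq> 0" for t
  proof -
    let ?q = "tilt t p"
    have z: "coeff_xy ?q i j = 0" if "?D < i + j" for i j
      using coeff_xy_eq_0[of ?q i j] total_degree_tilt_le[of t p] that by linarith
    then have "degree ?q \<le> ?D" by (intro degree_le) (auto simp: coeff_xy_def poly_eq_iff)
    have coeff0: "coeff_xy ?q 0 ?D = coeff (slice 0 ?q) ?D"
      by (simp add: coeff_slice coeff_xy_def poly_0_coeff_0)
    have "slice 0 ?q = (\<Sum>j\<le>degree p. \<Sum>i\<le>degree (coeff p j). monom (coeff_xy p i j * (- t) ^ i) (i + j))"
    proof (rule poly_ext)
      fix b
      have "eval_xy (const_xy c * (X - const_xy t * Y) ^ i * Y ^ j) 0 b = poly (monom (c * (- t) ^ i) (i + j)) b" for c i j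
      proof -
        have "(- (t * b)) ^ i = (- t) ^ i * b ^ i" by (metis mult_minus_left power_mult_distrib)
        then show ?thesis
          by (simp add: poly_monom power_add del: mult_pCons_left mult_pCons_right)
      qed
      then show "poly (slice 0 ?q) b = poly (\<Sum>j\<le>degree p. \<Sum>i\<le>degree (coeff p j). monom (coeff_xy p i j * (- t) ^ i) (i + j)) b"
        unfolding poly_slice tilt_def eval_xy_sum poly_sum by simp
    qed
    then have "coeff_xy ?q 0 ?D = (\<Sum>j\<le>degree p. \<Sum>i\<le>degree (coeff p j). if i + j = ?D then coeff_xy p i j * (- t) ^ i else 0)"
      using coeff0 by (simp add: coeff_sum)
    also have "\<dots> = (\<Sum>j\<le>degree p. if j \<le> ?D then coeff_xy p (?D - j) j * (- t) ^ (?D - j) else 0)"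
    proof (intro sum.cong refl)
      fix j
      have "(\<Sum>i\<le>degree (coeff p j). if i + j = ?D then coeff_xy p i j * (- t) ^ i else 0) =
        (\<Sum>i\<le>degree (coeff p j). if i = ?D - j \<and> j \<le> ?D then coeff_xy p (?D - j) j * (- t) ^ (?D - j) else 0)"
        by (intro sum.cong) auto
      also have "\<dots> = (if j \<le> ?D then coeff_xy p (?D - j) j * (- t) ^ (?D - j) else 0)"
        by (cases "j \<le> ?D") (auto simp: coeff_xy_def coeff_eq_0)
      finally show "(\<Sum>i\<le>degree (coeff p j). if i + j = ?D then coeff_xy p i j * (- t) ^ i else 0) =
        (if j \<le> ?D then coeff_xy p (?D - j) j * (- t) ^ (?D - j) else 0)" .
    qed
    also have "\<dots> = (\<Sum>j\<le>?D. coeff_xy p (?D - j) j * (- t) ^ (?D - j))"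
    proof (rule sum.mono_neutral_cong)
      fix j assume "j \<in> {..?D} - {..degree p}"
      then show "coeff_xy p (?D - j) j * (- t) ^ (?D - j) = 0" by (simp add: coeff_xy_def coeff_eq_0)
    qed auto
    also have "\<dots> = (\<Sum>i\<le>?D. coeff_xy p i (?D - i) * (- t) ^ i)"
      by (rule sum.reindex_bij_witness[of _ "\<lambda>i. ?D - i" "\<lambda>i. ?D - i"]) auto
    also have "\<dots> = poly h t"
      by (simp add: h_def poly_sum poly_monom power_minus[of t] mult_ac)
    finally have c: "coeff_xy ?q 0 ?D \<noteq> 0" using t by simp
    then have "coeff ?q ?D \<noteq> 0" by (auto simp: coeff_xy_def)
    with \<open>degree ?q \<le> ?D\<close> have deg: "degree ?q = ?D" using le_degree le_antisym by blast
    have "coeff ?q ?D = [:coeff_xy ?q 0 ?D:]"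
      using z[of _ ?D] by (auto simp: poly_eq_iff coeff_xy_def coeff_pCons split: nat.splits)
    with c deg show ?thesis by auto
  qed
  with fin show ?thesis by blast
qed

section \<open>The two implications\<close>

lemma jacobian_nonconstant:
  assumes J: "jacobian (f, g) = 1"
  shows "total_degree f > 0" "total_degree g > 0"
proof -
  have zero: "partial_x p = 0 \<and> partial_y p = 0" if "total_degree p = 0" for p
  proof -
    have "coeff_xy p i j = 0" if "i + j > 0" for i j
      using coeff_xy_eq_0[of p i j] \<open>total_degree p = 0\<close> that by simp
    then have "coeff_xy (partial_x p) i j = 0" "coeff_xy (partial_y p) i j = 0" for i j
      by (simp_all add: coeff_xy_partial_x coeff_xy_partial_y)
    then show ?thesis unfolding coeff_xy_def by (auto intro!: poly_eqI)
  qed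
  show "total_degree f > 0"
  proof (rule ccontr)
    assume "\<not> total_degree f > 0"
    with zero[of f] J show False by (simp add: jacobian_def)
  qed
  show "total_degree g > 0"
  proof (rule ccontr)
    assume "\<not> total_degree g > 0"
    with zero[of g] J show False by (simp add: jacobian_def)
  qed
qed

section \<open>Normal forms of Jacobian pairs\<close>

definition normal_pair :: "bpoly \<Rightarrow> bpoly \<Rightarrow> bool" where
  "normal_pair F G \<longleftrightarrow> lead_coeff F = 1 \<and> degree F > 0 \<and> degree G < degree F \<and> jacobian (F, G) = 1"

lemma jacobian_linear_combination:
  "jacobian (const_xy \<alpha> * p + const_xy \<beta> * q, const_xy \<gamma> * p + const_xy \<delta> * q)
     = const_xy (\<alpha> * \<delta> - \<beta> * \<gamma>) * jacobian (p, q)"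
proof -
  have c: "const_xy (\<alpha> * \<delta> - \<beta> * \<gamma>) = const_xy \<alpha> * const_xy \<delta> - const_xy \<beta> * const_xy \<gamma>" by simp
  show ?thesis
    unfolding c jacobian_def fst_conv snd_conv partial_x_add partial_y_add partial_x_mult partial_y_mult partial_const
    by (simp only: algebra_simps mult_zero_left add_0_left add_0_right mult_zero_right)
qed

text \<open>The polynomial of larger degree is scaled to be monic, and the other compensates the
  determinant. When the second has the larger degree, the two are exchanged with a sign.\<close>

lemma normalizing_combination:
  assumes p: "lead_coeff p = [:c:]" "c \<noteq> 0" "degree p > 0" and q: "lead_coeff q = [:e:]" "e \<noteq> 0" "degree q > 0"
  shows "\<exists>\<alpha> \<beta> \<gamma> \<delta>. \<alpha> * \<delta> - \<beta> * \<gamma> = 1 \<and>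
    lead_coeff (const_xy \<alpha> * p + const_xy \<beta> * q) = 1 \<and> degree (const_xy \<alpha> * p + const_xy \<beta> * q) > 0 \<and>
    degree (const_xy \<gamma> * p + const_xy \<delta> * q) < degree (const_xy \<alpha> * p + const_xy \<beta> * q)"
proof (cases "degree q \<le> degree p")
  case True
  \<comment> \<open>For equal degrees, \<open>- s * p + c * q\<close> cancels the leading
    coefficients \<open>c\<close> and \<open>e\<close>; for a smaller degree of \<open>q\<close>
    nothing has to be cancelled.\<close>
  define s where "s = (if degree q = degree p then e else 0)"
  have deg: "degree (const_xy (1 / c) * p + const_xy 0 * q) = degree p" using p(2) by simp
  moreover have "lead_coeff (const_xy (1 / c) * p + const_xy 0 * q) = 1"
    unfolding deg using p by (simp add: one_pCons)
  moreover have "degree (const_xy (- s) * p + const_xy c * q) < degree p"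
  proof (rule degree_lessI)
    show "\<forall>k\<ge>degree p. coeff (const_xy (- s) * p + const_xy c * q) k = 0"
    proof (intro allI impI)
      fix k assume k: "k \<ge> degree p"
      consider "k > degree p" | "k = degree p" "degree q = degree p" | "k = degree p" "degree q < degree p"
        using k True by linarith
      then show "coeff (const_xy (- s) * p + const_xy c * q) k = 0"
      proof cases
        case 1
        with True show ?thesis by (simp add: coeff_eq_0)
      next
        case 2
        with p(1) q(1) show ?thesis by (simp add: s_def)
      next
        case 3
        then show ?thesis by (simp add: s_def coeff_eq_0)
      qed
    qed
  qed (use p in simp)
  ultimately show ?thesis using p(2,3)
    by (intro exI[of _ "1 / c"] exI[of _ 0] exI[of _ "- s"] exI[of _ c]) (simp del: mult_pCons_left)
next
  case False
  have deg: "degree (const_xy 0 * p + const_xy (1 / e) * q) = degree q" using q(2) by simp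
  moreover have "lead_coeff (const_xy 0 * p + const_xy (1 / e) * q) = 1"
    unfolding deg using q by (simp add: one_pCons)
  moreover have "degree (const_xy (- e) * p + const_xy 0 * q) < degree q"
    using False degree_smult_le[of "[:- e:]" p] by simp
  ultimately show ?thesis using q(2,3)
    by (intro exI[of _ 0] exI[of _ "1 / e"] exI[of _ "- e"] exI[of _ 0]) (simp del: mult_pCons_left)
qed

lemma normal_form:
  assumes J: "jacobian (f, g) = 1"
  shows "\<exists>B. finite B \<and> (\<forall>t. t \<notin> B \<longrightarrow> (\<exists>\<alpha> \<beta> \<gamma> \<delta>. \<alpha> * \<delta> - \<beta> * \<gamma> = 1 \<and>
    normal_pair (const_xy \<alpha> * tilt t f + const_xy \<beta> * tilt t g) (const_xy \<gamma> * tilt t f + const_xy \<delta> * tilt t g)))"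
proof -
  note td = jacobian_nonconstant[OF J]
  obtain B where B: "finite B" "\<And>t. t \<notin> B \<Longrightarrow> \<exists>c. c \<noteq> 0 \<and> lead_coeff (tilt t f) = [:c:] \<and> degree (tilt t f) = total_degree f"
    using lead_coeff_tilt[OF td(1)] by blast
  obtain C where C: "finite C" "\<And>t. t \<notin> C \<Longrightarrow> \<exists>c. c \<noteq> 0 \<and> lead_coeff (tilt t g) = [:c:] \<and> degree (tilt t g) = total_degree g"
    using lead_coeff_tilt[OF td(2)] by blast
  have "\<exists>\<alpha> \<beta> \<gamma> \<delta>. \<alpha> * \<delta> - \<beta> * \<gamma> = 1 \<and>
    normal_pair (const_xy \<alpha> * tilt t f + const_xy \<beta> * tilt t g) (const_xy \<gamma> * tilt t f + const_xy \<delta> * tilt t g)"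
    if t: "t \<notin> B \<union> C" for t
  proof -
    obtain c where c: "c \<noteq> 0" "lead_coeff (tilt t f) = [:c:]" "degree (tilt t f) = total_degree f" using B(2) t by blast
    obtain e where e: "e \<noteq> 0" "lead_coeff (tilt t g) = [:e:]" "degree (tilt t g) = total_degree g" using C(2) t by blast
    have "degree (tilt t f) > 0" "degree (tilt t g) > 0" using td c(3) e(3) by simp_all
    from normalizing_combination[OF c(2,1) this(1) e(2,1) this(2)]
    obtain \<alpha> \<beta> \<gamma> \<delta> where *: "\<alpha> * \<delta> - \<beta> * \<gamma> = 1"
      "lead_coeff (const_xy \<alpha> * tilt t f + const_xy \<beta> * tilt t g) = 1"
      "degree (const_xy \<alpha> * tilt t f + const_xy \<beta> * tilt t g) > 0"
      "degree (const_xy \<gamma> * tilt t f + const_xy \<delta> * tilt t g) < degree (const_xy \<alpha> * tilt t f + const_xy \<beta> * tilt t g)"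
      by blast
    have one: "const_xy 1 = 1" by (simp add: one_pCons)
    have "jacobian (const_xy \<alpha> * tilt t f + const_xy \<beta> * tilt t g, const_xy \<gamma> * tilt t f + const_xy \<delta> * tilt t g) = 1"
      unfolding jacobian_linear_combination *(1) jacobian_tilt J one by simp
    with * show ?thesis unfolding normal_pair_def by blast
  qed
  with B(1) C(1) show ?thesis by (meson finite_UnI)
qed

lemma degree_diff_const:
  fixes p :: "'a::ab_group_add poly"
  assumes "degree p > 0"
  shows "degree (p - [:c:]) = degree p"
  unfolding diff_conv_add_uminus using assms by (intro degree_add_eq_left) simp

lemma degree_1_poly:
  assumes "degree p = 1"
  shows "p = [:coeff p 0, coeff p 1:]" "coeff p 1 \<noteq> 0"
proof -
  show "p = [:coeff p 0, coeff p 1:]"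
    using assms by (intro poly_eqI) (auto simp: coeff_pCons coeff_eq_0 split: nat.splits)
  show "coeff p 1 \<noteq> 0" using assms by (metis degree_0 leading_coeff_0_iff zero_neq_one)
qed

lemma linear_root:
  fixes s :: "'a::field"
  assumes "s \<noteq> 0"
  shows "c + x * s = 0 \<longleftrightarrow> x = - c / s"
  by (simp only: nonzero_eq_divide_eq[OF assms] eq_neg_iff_add_eq_0 add.commute)

lemma normal_pair_shift:
  assumes "normal_pair F G"
  shows "normal_pair (F - const_xy u) (G - const_xy v)"
proof -
  have F: "lead_coeff F = 1" "degree F > 0" "degree G < degree F" "jacobian (F, G) = 1"
    using assms by (simp_all add: normal_pair_def)
  have deg: "degree (F - const_xy u) = degree F"
    using F(2) by (rule degree_diff_const)
  have "coeff (const_xy u) (degree F) = 0" using F(2) by (simp add: coeff_eq_0)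
  then have "lead_coeff (F - const_xy u) = 1" unfolding deg using F(1) by simp
  moreover have "degree (G - const_xy v) < degree F" using F(2,3) by (intro degree_diff_less) auto
  moreover have "jacobian (F - const_xy u, G - const_xy v) = 1"
    using F(4) by (simp add: jacobian_def partial_x_diff partial_y_diff)
  ultimately show ?thesis using F(2) deg by (simp add: normal_pair_def)
qed

text \<open>The \<open>x\<close>-coordinates are roots of the nonzero norm, and a monic
  \<open>F\<close> has finitely many zeros on each vertical line.\<close>

lemma normal_pair_finite_zeros:
  assumes "normal_pair F G"
  shows "finite (curve F \<inter> curve G)"
proof -
  have F: "lead_coeff F = 1" "degree F > 0" "jacobian (F, G) = 1" using assms by (simp_all add: normal_pair_def)
  have "poly_norm F G \<noteq> 0" using poly_norm_nonzero[OF F(1,2) jacobian_coprime[OF F(1,3)]] .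
  then have "finite {a. poly (poly_norm F G) a = 0}" by (rule poly_roots_finite)
  moreover have "finite {b. poly (slice a F) b = 0}" for a
    using slice_monic[OF F(1), of a] by (intro poly_roots_finite) auto
  ultimately have "finite (SIGMA a:{a. poly (poly_norm F G) a = 0}. {b. poly (slice a F) b = 0})"
    by (rule finite_SigmaI)
  moreover have "curve F \<inter> curve G \<subseteq> (SIGMA a:{a. poly (poly_norm F G) a = 0}. {b. poly (slice a F) b = 0})"
    using poly_norm_eq_0_iff[OF F(1,2), of G] by (auto simp: curve_def)
  ultimately show ?thesis by (rule finite_subset[rotated])
qed

lemma linear_system_trivial:
  fixes \<alpha> :: complex
  assumes "\<alpha> * \<delta> - \<beta> * \<gamma> = 1"
  shows "\<alpha> * x + \<beta> * y = 0 \<and> \<gamma> * x + \<delta> * y = 0 \<longleftrightarrow> x = 0 \<and> y = 0"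
proof
  assume *: "\<alpha> * x + \<beta> * y = 0 \<and> \<gamma> * x + \<delta> * y = 0"
  have "x = (\<alpha> * \<delta> - \<beta> * \<gamma>) * x" by (simp add: assms)
  also have "\<dots> = \<delta> * (\<alpha> * x + \<beta> * y) - \<beta> * (\<gamma> * x + \<delta> * y)" by (simp only: algebra_simps)
  finally have "x = \<delta> * (\<alpha> * x + \<beta> * y) - \<beta> * (\<gamma> * x + \<delta> * y)" .
  then have x: "x = 0" unfolding conjunct1[OF *] conjunct2[OF *] by simp
  have "y = (\<alpha> * \<delta> - \<beta> * \<gamma>) * y" by (simp add: assms)
  also have "\<dots> = \<alpha> * (\<gamma> * x + \<delta> * y) - \<gamma> * (\<alpha> * x + \<beta> * y)" by (simp only: algebra_simps)
  finally have "y = 0" unfolding conjunct1[OF *] conjunct2[OF *] by simp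
  with x show "x = 0 \<and> y = 0" ..
qed simp

lemma curve_normal_form:
  assumes "\<alpha> * \<delta> - \<beta> * \<gamma> = 1"
  shows "(a, b) \<in> curve (const_xy \<alpha> * tilt t f + const_xy \<beta> * tilt t g) \<inter> curve (const_xy \<gamma> * tilt t f + const_xy \<delta> * tilt t g)
     \<longleftrightarrow> (a - t * b, b) \<in> curve f \<inter> curve g"
  using linear_system_trivial[OF assms] by (simp add: curve_def del: mult_pCons_left)

lemma finite_zeros:
  assumes J: "jacobian (f, g) = 1"
  shows "finite (curve f \<inter> curve g)"
proof -
  obtain B where B: "finite B" "\<And>t. t \<notin> B \<Longrightarrow> \<exists>\<alpha> \<beta> \<gamma> \<delta>. \<alpha> * \<delta> - \<beta> * \<gamma> = 1 \<and>
    normal_pair (const_xy \<alpha> * tilt t f + const_xy \<beta> * tilt t g) (const_xy \<gamma> * tilt t f + const_xy \<delta> * tilt t g)"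
    using normal_form[OF J] by blast
  obtain t where "t \<notin> B" using ex_new_if_finite[OF infinite_UNIV_char_0 B(1)] by blast
  with B(2) obtain \<alpha> \<beta> \<gamma> \<delta> where det: "\<alpha> * \<delta> - \<beta> * \<gamma> = 1"
    and N: "normal_pair (const_xy \<alpha> * tilt t f + const_xy \<beta> * tilt t g) (const_xy \<gamma> * tilt t f + const_xy \<delta> * tilt t g)"
    by blast
  let ?Z = "curve (const_xy \<alpha> * tilt t f + const_xy \<beta> * tilt t g) \<inter> curve (const_xy \<gamma> * tilt t f + const_xy \<delta> * tilt t g)"
  have "finite ((\<lambda>(a, b). (a - t * b, b)) ` ?Z)" using normal_pair_finite_zeros[OF N] by (rule finite_imageI)
  moreover have "curve f \<inter> curve g \<subseteq> (\<lambda>(a, b). (a - t * b, b)) ` ?Z"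
  proof
    fix z assume z: "z \<in> curve f \<inter> curve g"
    obtain a b where ab: "z = (a, b)" by force
    have "(a + t * b, b) \<in> ?Z" using z unfolding curve_normal_form[OF det] ab by simp
    then show "z \<in> (\<lambda>(a, b). (a - t * b, b)) ` ?Z" unfolding ab by (rule rev_image_eqI) simp
  qed
  ultimately show ?thesis by (rule finite_subset[rotated])
qed

text \<open>For generic \<open>t\<close> the tilted zeros are vertically separated, so the norm is
  linear: it has one root, and separation leaves one zero above it.\<close>

lemma unique_zero:
  assumes S: noether_coefficient_one and J: "jacobian (f, g) = 1"
  shows "\<exists>!z. z \<in> curve f \<inter> curve g"
proof -
  let ?Z = "curve f \<inter> curve g"
  obtain B where B: "finite B" "\<And>t. t \<notin> B \<Longrightarrow> \<exists>\<alpha> \<beta> \<gamma> \<delta>. \<alpha> * \<delta> - \<beta> * \<gamma> = 1 \<and>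
    normal_pair (const_xy \<alpha> * tilt t f + const_xy \<beta> * tilt t g) (const_xy \<gamma> * tilt t f + const_xy \<delta> * tilt t g)"
    using normal_form[OF J] by blast
  \<comment> \<open>The values of \<open>t\<close> at which two zeros with different
    \<open>y\<close>-coordinates acquire the same tilted \<open>x\<close>-coordinate
    \<open>a + t * b\<close>. Pairs with equal \<open>y\<close>-coordinates only add 0, the value of
    a division by zero.\<close>
  define C where "C = (\<lambda>((a, b), (a', b')). (a' - a) / (b - b')) ` (?Z \<times> ?Z)"
  have "finite (B \<union> C)" using B(1) finite_zeros[OF J] by (simp add: C_def)
  then obtain t where t: "t \<notin> B" "t \<notin> C" using ex_new_if_finite[OF infinite_UNIV_char_0] by blast
  from B(2)[OF t(1)] obtain \<alpha> \<beta> \<gamma> \<delta> where det: "\<alpha> * \<delta> - \<beta> * \<gamma> = 1"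
    and N: "normal_pair (const_xy \<alpha> * tilt t f + const_xy \<beta> * tilt t g) (const_xy \<gamma> * tilt t f + const_xy \<delta> * tilt t g)"
    by blast
  define F where "F = const_xy \<alpha> * tilt t f + const_xy \<beta> * tilt t g"
  define G where "G = const_xy \<gamma> * tilt t f + const_xy \<delta> * tilt t g"
  have zeros: "(a, b) \<in> curve F \<inter> curve G \<longleftrightarrow> (a - t * b, b) \<in> ?Z" for a b
    unfolding F_def G_def by (rule curve_normal_form[OF det])
  have sep: "vertically_separated F G"
    unfolding vertically_separated_def zeros
  proof (intro allI impI)
    fix a b b' assume *: "(a - t * b, b) \<in> ?Z" "(a - t * b', b') \<in> ?Z"
    show "b = b'"
    proof (rule ccontr)
      assume "b \<noteq> b'"
      then have "t = ((a - t * b') - (a - t * b)) / (b - b')" by (simp add: field_simps)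
      moreover have "((a - t * b') - (a - t * b)) / (b - b') \<in> C"
        unfolding C_def using * by (intro image_eqI[of _ _ "((a - t * b, b), (a - t * b', b'))"]) auto
      ultimately show False using t(2) by simp
    qed
  qed
  have FG: "lead_coeff F = 1" "degree F > 0" "degree G < degree F" "jacobian (F, G) = 1"
    using N by (simp_all add: normal_pair_def F_def G_def)
  obtain r s where R: "poly_norm F G = [:r, s:]" "s \<noteq> 0"
    using degree_1_poly[OF degree_poly_norm_eq_1[OF S FG sep]] by blast
  have root: "poly (poly_norm F G) a = 0 \<longleftrightarrow> a = - r / s" for a
    using linear_root[OF R(2), of r a] by (simp add: R(1))
  obtain b where b: "(- r / s, b) \<in> curve F \<inter> curve G"
    using poly_norm_eq_0_iff[OF FG(1,2), of G "- r / s"] root by (auto simp: curve_def)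
  show ?thesis
  proof (rule ex1I[of _ "(- r / s - t * b, b)"])
    show "(- r / s - t * b, b) \<in> ?Z" using b unfolding zeros .
  next
    fix z assume z: "z \<in> ?Z"
    obtain a' b' where ab: "z = (a', b')" by force
    have z': "(a' + t * b', b') \<in> curve F \<inter> curve G" unfolding zeros using z ab by simp
    then have "poly (poly_norm F G) (a' + t * b') = 0"
      using poly_norm_eq_0_iff[OF FG(1,2), of G "a' + t * b'"] by (auto simp: curve_def)
    then have a': "a' + t * b' = - r / s" by (simp only: root)
    then have "b' = b" using sep z' b unfolding vertically_separated_def by metis
    with a' ab show "z = (- r / s - t * b, b)" by (simp add: algebra_simps eq_diff_eq)
  qed
qed

text \<open>Translating the target moves any value \<open>(u, v)\<close> to the origin and leaves
  the Jacobian unchanged.\<close>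

lemma bij_polynomial_map:
  assumes S: noether_coefficient_one and J: "jacobian (f, g) = 1"
  shows "bij (polynomial_map (f, g))"
  unfolding bij_iff
proof
  fix w :: "complex \<times> complex"
  obtain u v where w: "w = (u, v)" by force
  have "jacobian (f - const_xy u, g - const_xy v) = 1"
    using J by (simp add: jacobian_def partial_x_diff partial_y_diff)
  from unique_zero[OF S this] show "\<exists>!z. polynomial_map (f, g) z = w"
    by (simp add: curve_def polynomial_map_def w case_prod_beta)
qed

section \<open>Polynomial dependence of the preimage on the target\<close>

lemma comm_ring_hom_eval_xy: "comm_ring_hom (\<lambda>p. eval_xy p u v)"
  by unfold_locales simp_all

lemma comm_ring_hom_const_xy: "comm_ring_hom const_xy"
  by unfold_locales (simp_all add: one_pCons)

text \<open>The target point becomes a parameter: the coefficients in \<open>bpoly poly\<close> are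
  polynomials in \<open>u\<close> and \<open>v\<close>, for which \<open>X\<close> and
  \<open>Y\<close> stand here, and the outer variable is the \<open>x\<close> of the source. One
  norm is formed and then specialised by \<open>poly_norm_hom\<close>.\<close>

lemma poly_norm_family:
  assumes F: "lead_coeff F = 1" "degree F > 0"
  shows "\<exists>R :: bpoly poly. \<forall>u v. map_poly (\<lambda>p. eval_xy p u v) R = poly_norm (F - const_xy u) (G - const_xy v)"
proof -
  define F' where "F' = map_poly (map_poly const_xy) F - [:[:X:]:]"
  define G' where "G' = map_poly (map_poly const_xy) G - [:[:Y:]:]"
  interpret k: map_poly_comm_ring_hom const_xy
    by (rule map_poly_comm_ring_hom.intro) (rule comm_ring_hom_const_xy)
  have deg: "degree (map_poly (map_poly const_xy) F) = degree F" "lead_coeff (map_poly (map_poly const_xy) F) = 1"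
    using degree_map_poly_monic[OF k.comm_ring_hom_axioms F(1)] by simp_all
  have degF': "degree F' = degree F"
    unfolding F'_def using F(2) deg(1) by (simp add: degree_diff_const)
  have "lead_coeff F' = 1"
  proof -
    have "coeff [:[:X:]:] (degree F) = 0" using F(2) by (simp add: coeff_eq_0)
    then show ?thesis unfolding degF' using deg by (simp add: F'_def)
  qed
  have "map_poly (\<lambda>p. eval_xy p u v) (poly_norm F' G') = poly_norm (F - const_xy u) (G - const_xy v)" for u v
  proof -
    let ?e = "\<lambda>p. eval_xy p u v"
    interpret e: map_poly_comm_ring_hom ?e
      by (rule map_poly_comm_ring_hom.intro) (rule comm_ring_hom_eval_xy)
    have ev_const: "map_poly ?e (map_poly const_xy q) = q" for q
      by (rule poly_eqI) (simp add: coeff_map_poly)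
    have ev_coeff: "map_poly ?e [:x:] = [:?e x:]" for x
      by (rule poly_eqI) (simp add: coeff_map_poly coeff_pCons split: nat.splits)
    have "map_poly (map_poly ?e) (map_poly (map_poly const_xy) p - [:[:x:]:]) = p - const_xy (?e x)" for p x
      by (rule poly_eqI)
         (simp add: coeff_map_poly e.hom_minus ev_const ev_coeff coeff_pCons split: nat.splits)
    then have "map_poly (map_poly ?e) F' = F - const_xy u" "map_poly (map_poly ?e) G' = G - const_xy v"
      by (simp_all add: F'_def G'_def)
    moreover have "poly_norm (map_poly (map_poly ?e) F') (map_poly (map_poly ?e) G') = map_poly ?e (poly_norm F' G')"
      by (rule poly_norm_hom[OF e.comm_ring_hom_axioms \<open>lead_coeff F' = 1\<close>]) (use degF' F in simp)
    ultimately show ?thesis by simp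
  qed
  then show ?thesis by blast
qed

text \<open>The tilted \<open>x\<close>-coordinate \<open>a + t * b\<close> of a preimage is the
  root of a norm linear in \<open>x\<close>. Its leading coefficient has no zero as a polynomial in
  the target, so it is constant and the root is polynomial in the target.\<close>

lemma inverse_linear_form:
  assumes S: noether_coefficient_one and J: "jacobian (f, g) = 1"
  shows "\<exists>B. finite B \<and> (\<forall>t. t \<notin> B \<longrightarrow>
    (\<exists>l. \<forall>a b. eval_xy l (eval_xy f a b) (eval_xy g a b) = a + t * b))"
proof -
  obtain B where B: "finite B" "\<And>t. t \<notin> B \<Longrightarrow> \<exists>\<alpha> \<beta> \<gamma> \<delta>. \<alpha> * \<delta> - \<beta> * \<gamma> = 1 \<and>
    normal_pair (const_xy \<alpha> * tilt t f + const_xy \<beta> * tilt t g) (const_xy \<gamma> * tilt t f + const_xy \<delta> * tilt t g)"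
    using normal_form[OF J] by blast
  have "\<exists>l. \<forall>a b. eval_xy l (eval_xy f a b) (eval_xy g a b) = a + t * b" if t: "t \<notin> B" for t
  proof -
    from B(2)[OF t] obtain \<alpha> \<beta> \<gamma> \<delta> where det: "\<alpha> * \<delta> - \<beta> * \<gamma> = 1"
      and N: "normal_pair (const_xy \<alpha> * tilt t f + const_xy \<beta> * tilt t g) (const_xy \<gamma> * tilt t f + const_xy \<delta> * tilt t g)"
      by blast
    define F where "F = const_xy \<alpha> * tilt t f + const_xy \<beta> * tilt t g"
    define G where "G = const_xy \<gamma> * tilt t f + const_xy \<delta> * tilt t g"
    have N: "normal_pair F G" using N by (simp add: F_def G_def)
    then have FG: "lead_coeff F = 1" "degree F > 0" by (simp_all add: normal_pair_def)
    obtain R where R: "\<And>u v. map_poly (\<lambda>p. eval_xy p u v) R = poly_norm (F - const_xy u) (G - const_xy v)"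
      using poly_norm_family[OF FG] by blast
    have deg: "degree (map_poly (\<lambda>p. eval_xy p u v) R) = 1" for u v
    proof -
      note N' = normal_pair_shift[OF N, of u v]
      then have N'': "lead_coeff (F - const_xy u) = 1" "degree (F - const_xy u) > 0"
        "degree (G - const_xy v) < degree (F - const_xy u)" "jacobian (F - const_xy u, G - const_xy v) = 1"
        by (simp_all add: normal_pair_def)
      have "vertically_separated (F - const_xy u) (G - const_xy v)"
        using unique_zero[OF S N''(4)] unfolding vertically_separated_def by blast
      then show ?thesis unfolding R using degree_poly_norm_eq_1[OF S N''] by blast
    qed
    have c: "coeff (map_poly (\<lambda>p. eval_xy p u v) R) k = eval_xy (coeff R k) u v" for u v k
      by (simp add: coeff_map_poly)
    have "eval_xy (coeff R 1) u v \<noteq> 0" for u v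
      using deg[of u v] c[of u v 1] leading_coeff_0_iff[of "map_poly (\<lambda>p. eval_xy p u v) R"] by force
    then obtain s where s: "\<And>u v. eval_xy (coeff R 1) u v = s" "s \<noteq> 0"
      using nonvanishing_imp_constant[of "coeff R 1"] by metis
    define l where "l = const_xy (- 1 / s) * coeff R 0"
    have root: "x = eval_xy l u v" if x: "poly (poly_norm (F - const_xy u) (G - const_xy v)) x = 0" for u v x
    proof -
      have "map_poly (\<lambda>p. eval_xy p u v) R = [:eval_xy (coeff R 0) u v, s:]"
        using degree_1_poly(1)[OF deg[of u v]] unfolding c s(1) .
      with x have "eval_xy (coeff R 0) u v + x * s = 0" unfolding R[symmetric] by simp
      then have "x = - eval_xy (coeff R 0) u v / s"
        by (simp only: linear_root[OF s(2)])
      then show ?thesis unfolding l_def eval_xy_mult eval_xy_const by simp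
    qed
    have val: "eval_xy l (\<alpha> * eval_xy f a b + \<beta> * eval_xy g a b) (\<gamma> * eval_xy f a b + \<delta> * eval_xy g a b) = a + t * b" for a b
    proof -
      let ?u = "\<alpha> * eval_xy f a b + \<beta> * eval_xy g a b" and ?v = "\<gamma> * eval_xy f a b + \<delta> * eval_xy g a b"
      have "lead_coeff (F - const_xy ?u) = 1" "degree (F - const_xy ?u) > 0"
        using normal_pair_shift[OF N, of ?u ?v] unfolding normal_pair_def by blast+
      moreover have "eval_xy (F - const_xy ?u) (a + t * b) b = 0" "eval_xy (G - const_xy ?v) (a + t * b) b = 0"
        by (simp_all add: F_def G_def del: mult_pCons_left)
      ultimately have "poly (poly_norm (F - const_xy ?u) (G - const_xy ?v)) (a + t * b) = 0"
        using poly_norm_eq_0_iff by blast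
      from root[OF this] show ?thesis by simp
    qed
    \<comment> \<open>Composition with the linear change of the target replaces the combinations by
      \<open>f\<close> and \<open>g\<close> themselves.\<close>
    obtain q where "\<And>u v. eval_xy q u v = eval_xy l (eval_xy (const_xy \<alpha> * X + const_xy \<beta> * Y) u v) (eval_xy (const_xy \<gamma> * X + const_xy \<delta> * Y) u v)"
      using eval_xy_subst by metis
    then have "eval_xy q u v = eval_xy l (\<alpha> * u + \<beta> * v) (\<gamma> * u + \<delta> * v)" for u v
      by (simp del: mult_pCons_left)
    with val have "\<forall>a b. eval_xy q (eval_xy f a b) (eval_xy g a b) = a + t * b" by simp
    then show ?thesis by (rule exI)
  qed
  with B(1) show ?thesis by blast
qed

text \<open>Two admissible values of \<open>t\<close> give two independent linear forms in
  \<open>a\<close> and \<open>b\<close>, from which both coordinates are recovered.\<close>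

lemma polynomial_inverse:
  assumes S: noether_coefficient_one and J: "jacobian (f, g) = 1"
  shows "\<exists>h. inv_into UNIV (polynomial_map (f, g)) = polynomial_map h"
proof -
  obtain B where B: "finite B" "\<And>t. t \<notin> B \<Longrightarrow> \<exists>l. \<forall>a b. eval_xy l (eval_xy f a b) (eval_xy g a b) = a + t * b"
    using inverse_linear_form[OF S J] by blast
  obtain t where t: "t \<notin> B" using ex_new_if_finite[OF infinite_UNIV_char_0 B(1)] by blast
  obtain t' where t': "t' \<notin> insert t B" using ex_new_if_finite[OF infinite_UNIV_char_0, of "insert t B"] B(1) by blast
  obtain l where l: "\<And>a b. eval_xy l (eval_xy f a b) (eval_xy g a b) = a + t * b" using B(2)[OF t] by blast
  obtain l' where l': "\<And>a b. eval_xy l' (eval_xy f a b) (eval_xy g a b) = a + t' * b" using B(2)[of t'] t' by blast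
  define hb where "hb = const_xy (1 / (t - t')) * (l - l')"
  define ha where "ha = l - const_xy t * hb"
  have tt: "t - t' \<noteq> 0" using t' by auto
  have hb: "eval_xy hb (eval_xy f a b) (eval_xy g a b) = b" for a b
  proof -
    have "eval_xy hb (eval_xy f a b) (eval_xy g a b) = 1 / (t - t') * ((a + t * b) - (a + t' * b))"
      by (simp add: hb_def l l' del: mult_pCons_left)
    also have "(a + t * b) - (a + t' * b) = (t - t') * b" by (simp add: algebra_simps)
    finally show ?thesis using tt by simp
  qed
  have ha: "eval_xy ha (eval_xy f a b) (eval_xy g a b) = a" for a b
    by (simp add: ha_def l hb del: mult_pCons_left)
  have "surj (polynomial_map (f, g))" using bij_polynomial_map[OF S J] by (rule bij_is_surj)
  moreover have "polynomial_map (ha, hb) (polynomial_map (f, g) z) = z" for z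
    by (cases z) (simp add: polynomial_map_def ha hb)
  ultimately have "inv_into UNIV (polynomial_map (f, g)) w = polynomial_map (ha, hb) w" for w
    by (metis surj_f_inv_f)
  then show ?thesis by blast
qed

section \<open>From the Jacobian Conjecture to the coefficient\<close>

lemma x_power_plus_lower_axis:
  assumes "x_power_plus_lower n p"
  shows "degree (coeff p 0) = n" "lead_coeff (coeff p 0) = 1"
proof -
  obtain r where r: "p = X ^ n + r" "total_degree r < n" using assms by (auto simp: x_power_plus_lower_def)
  have c: "coeff (coeff p 0) i = (if i = n then 1 else coeff_xy r i 0)" if "i \<ge> n" for i
    using coeff_xy_X_power[of n i 0] coeff_xy_eq_0[of r i 0] r that by (auto simp: coeff_xy_def)
  have "coeff (coeff p 0) i = 0" if "i > n" for i
    using c[of i] coeff_xy_eq_0[of r i 0] r(2) that by simp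
  then have "degree (coeff p 0) \<le> n" by (intro degree_le) auto
  moreover have "coeff (coeff p 0) n = 1" using c[of n] by simp
  ultimately show "degree (coeff p 0) = n" using le_degree[of "coeff p 0" n] by simp
  with \<open>coeff (coeff p 0) n = 1\<close> show "lead_coeff (coeff p 0) = 1" by simp
qed

lemma eval_xy_axis: "eval_xy p a 0 = poly (coeff p 0) a"
  by (simp add: eval_xy_def poly_0_coeff_0)

lemma jacobian_conjecture_imp_coefficient:
  assumes JC: jacobian_conjecture_2 and J: "jacobian (f1, f2) = 1" and n: "n > 0"
    and x: "x_power_plus_lower n f1" "x_power_plus_lower n f2"
    and axis: "curve f1 \<inter> curve f2 \<subseteq> {(a, b). b = 0}"
    and deg: "total_degree g1 \<le> n - 1" "total_degree g2 \<le> n - 1"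
    and Y: "Y = g1 * f1 + g2 * f2"
  shows "coeff_xy g2 (n - 1) 0 = 1"
proof -
  have bij: "bij (polynomial_map (f1, f2))" using JC J by (simp add: jacobian_conjecture_2_def)
  obtain a b where "polynomial_map (f1, f2) (a, b) = (0, 0)"
    using bij_is_surj[OF bij] by (metis surjD surj_pair)
  then have ab: "(a, b) \<in> curve f1 \<inter> curve f2" by (simp add: polynomial_map_def curve_def)
  with axis have "b = 0" by blast
  with ab have a: "eval_xy f1 a 0 = 0" "eval_xy f2 a 0 = 0" by (simp_all add: curve_def)
  have uniq: "a' = a" if "eval_xy f1 a' 0 = 0" "eval_xy f2 a' 0 = 0" for a'
  proof -
    have "polynomial_map (f1, f2) (a', 0) = polynomial_map (f1, f2) (a, 0)"
      using a that by (simp add: polynomial_map_def)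
    then show ?thesis using injD[OF bij_is_inj[OF bij]] by blast
  qed
  define p where "p = coeff f1 0"
  define q where "q = coeff f2 0"
  have pq: "degree p = n" "lead_coeff p = 1" "degree q = n" "lead_coeff q = 1"
    using x_power_plus_lower_axis x by (simp_all add: p_def q_def)
  have pa: "poly p a = 0" and qa: "poly q a = 0" using a by (simp_all add: eval_xy_axis p_def q_def)
  obtain p' where p': "p = [:- a, 1:] * p'" using pa unfolding poly_eq_0_iff_dvd by (rule dvdE)
  obtain q' where q': "q = [:- a, 1:] * q'" using qa unfolding poly_eq_0_iff_dvd by (rule dvdE)
  have "eval_xy (partial_x f1) a 0 = poly (pderiv p) a" "eval_xy (partial_x f2) a 0 = poly (pderiv q) a"
    by (simp_all add: eval_xy_axis partial_x_def coeff_map_poly p_def q_def)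
  then have fx: "eval_xy (partial_x f1) a 0 = poly p' a" "eval_xy (partial_x f2) a 0 = poly q' a"
    unfolding p' q' by (simp_all add: pderiv_mult pderiv_pCons del: mult_pCons_left)
  have p0: "p' \<noteq> 0" "q' \<noteq> 0" using pq n p' q' by auto
  have degp: "degree p' = n - 1"
  proof -
    have "degree p = 1 + degree p'" unfolding p' using p0 by (subst degree_mult_eq) auto
    with pq(1) show ?thesis by simp
  qed
  have leadp: "lead_coeff p' = 1" using pq(2) unfolding p' lead_coeff_mult by simp
  \<comment> \<open>A common root gives a zero of the pair on the axis, hence equals
    \<open>a\<close>; but at \<open>a\<close> both \<open>x\<close>-derivatives would then
    vanish.\<close>
  have cop: "coprime p' q'"
  proof (rule ccontr)
    assume "\<not> coprime p' q'"
    then obtain c where c: "poly p' c = 0" "poly q' c = 0" using not_coprime_common_root[OF p0(1)] by blast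
    then have "eval_xy f1 c 0 = 0" "eval_xy f2 c 0 = 0"
      by (simp_all add: eval_xy_axis flip: p_def q_def) (simp_all add: p' q' del: mult_pCons_left)
    then have "c = a" by (rule uniq)
    with c fx eval_jacobian[OF J, of a 0] show False by simp
  qed
  have "coeff g1 0 * p + coeff g2 0 * q = 0"
    using arg_cong[OF Y, of "\<lambda>p. coeff p 0"] by (simp add: Y_def p_def q_def coeff_mult)
  then have "[:- a, 1:] * (coeff g1 0 * p' + coeff g2 0 * q') = 0"
    unfolding p' q' by (simp only: algebra_simps)
  then have eq: "coeff g1 0 * p' = - (coeff g2 0 * q')"
    by (simp only: mult_eq_0_iff eq_neg_iff_add_eq_0) simp
  then have "p' dvd coeff g2 0 * q'" by (metis dvd_minus_iff dvd_triv_right)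
  then have "p' dvd coeff g2 0" using cop by (simp add: coprime_dvd_mult_left_iff)
  then obtain k where k: "coeff g2 0 = p' * k" ..
  have g1: "coeff g1 0 = - (k * q')"
  proof -
    have "(coeff g1 0 + k * q') * p' = 0" using eq unfolding k by (simp add: algebra_simps)
    with p0 show ?thesis by (simp add: eq_neg_iff_add_eq_0)
  qed
  have "degree (coeff g2 0) \<le> n - 1"
  proof (rule degree_le, intro allI impI)
    fix i assume "n - 1 < i"
    then show "coeff (coeff g2 0) i = 0" using coeff_xy_eq_0[of g2 i 0] deg(2) by (simp add: coeff_xy_def)
  qed
  \<comment> \<open>The factor \<open>p'\<close> already exhausts the degree bound
    \<open>n - 1\<close>.\<close>
  then have "degree k = 0"
  proof (cases "k = 0")
    case False
    then have "degree (coeff g2 0) = (n - 1) + degree k" unfolding k using p0 degp by (simp add: degree_mult_eq)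
    with \<open>degree (coeff g2 0) \<le> n - 1\<close> show ?thesis by simp
  qed simp
  then obtain c where c: "k = [:c:]" by (rule degree_eq_zeroE)
  have coef: "coeff_xy g2 (n - 1) 0 = c"
    using leadp unfolding degp by (simp add: coeff_xy_def k c)
  \<comment> \<open>Since \<open>f1\<close> and \<open>f2\<close> vanish at \<open>(a, 0)\<close>,
    the derivatives of \<open>g1\<close> and \<open>g2\<close> drop out, and what remains is
    \<open>c\<close> times the Jacobian.\<close>
  have "eval_xy (partial_y (g1 * f1 + g2 * f2)) a 0 = 1"
    unfolding Y[symmetric] by simp
  then have "eval_xy g1 a 0 * eval_xy (partial_y f1) a 0 + eval_xy g2 a 0 * eval_xy (partial_y f2) a 0 = 1"
    using a by (simp add: partial_y_add partial_y_mult)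
  moreover have "eval_xy g1 a 0 = - (c * poly q' a)" "eval_xy g2 a 0 = c * poly p' a"
    by (simp_all add: eval_xy_axis g1 k c)
  ultimately have "c * (poly p' a * eval_xy (partial_y f2) a 0 - eval_xy (partial_y f1) a 0 * poly q' a) = 1"
    by (simp add: algebra_simps)
  moreover have "poly p' a * eval_xy (partial_y f2) a 0 - eval_xy (partial_y f1) a 0 * poly q' a = 1"
    using eval_jacobian[OF J, of a 0] by (simp add: fx)
  ultimately show ?thesis using coef by simp
qed

theorem corollary5p3:
  "jacobian_conjecture_2 \<longleftrightarrow>
     (\<forall>f1 f2 g1 g2 :: bpoly. \<forall>n :: nat.
        jacobian (f1, f2) = 1 \<longrightarrow>
        n > 0 \<longrightarrow> x_power_plus_lower n f1 \<longrightarrow> x_power_plus_lower n f2 \<longrightarrow>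
        curve f1 \<inter> curve f2 \<subseteq> {(a, b). b = 0} \<longrightarrow>
        total_degree g1 \<le> n - 1 \<longrightarrow> total_degree g2 \<le> n - 1 \<longrightarrow>
        Y = g1 * f1 + g2 * f2 \<longrightarrow>
        coeff_xy g2 (n - 1) 0 = 1)"
proof -
  have "jacobian_conjecture_2 \<longleftrightarrow> noether_coefficient_one"
  proof
    assume jacobian_conjecture_2
    then show noether_coefficient_one
      unfolding noether_coefficient_one_def using jacobian_conjecture_imp_coefficient by blast
  next
    assume S: noether_coefficient_one
    show jacobian_conjecture_2
      unfolding jacobian_conjecture_2_def
    proof (intro allI impI)
      fix f :: "bpoly \<times> bpoly" assume "jacobian f = 1"
      then have J: "jacobian (fst f, snd f) = 1" by simp
      show "bij (polynomial_map f) \<and> (\<exists>h. inv_into UNIV (polynomial_map f) = polynomial_map h)"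
        using bij_polynomial_map[OF S J] polynomial_inverse[OF S J] by simp
    qed
  qed
  then show ?thesis unfolding noether_coefficient_one_def .
qed

end
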